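(* Let $G$ be a finitely generated virtually abelian group, let $S$ be any finite generating set of $G$, and let $N$ be a torsion-free abelian normal subgroup of finite index in $G$. Let $\varphi\in\operatorname{End}(G)$ with $\varphi(N)\subset N$. Then, as $k\to\infty$, $$f_Q(k)=\Theta\big(f_R^S(k)\big)=\Theta\left(k^{\,\operatorname{rank}(N)-\min\limits_{gN\in G/N}\operatorname{rank}(\operatorname{Id}_N-\tau_g\circ\varphi|_N)}\right).$$
   Context: For a group $G$ with finite generating set $S$, the word length $|g|_S$ of $g\in G$ is the minimal $k\in\mathbb{N}=\{0,1,2,\dots\}$ such that $g=s_1\cdots s_k$ with $s_i\in S\cup S^{-1}$, and $B_G^S(r)=\{g\in G : |g|_S\le r\}$. For an endomorphism $\psi$ of a group $H$, elements $g,h\in H$ are $\psi$-twisted conjugate if there is $z\in H$ with $g=zh\psi(z)^{-1}$. This is an equivalence relation; the class of $g$ is denoted $[g]_\psi$ and the number of classes is the Reidemeister number $R(\psi)$. The twisted conjugacy growth function of $\varphi\in\operatorname{End}(G)$ with respect to $S$ is $f_R^S(r)=\#\{[g]_\varphi : g\in B_G^S(r)\}$. Identify $N$ with $\mathbb{Z}^n$, $n=\operatorname{rank}(N)$. For every positive integer $k$, the subgroup $(k\mathbb{Z})^n$ of $N$ (that is, $\{x^k : x\in N\}$ in multiplicative notation) is a finite index normal subgroup of $G$ and is mapped into itself by $\varphi$, so $\varphi$ induces $\overline{\varphi}_k\in\operatorname{End}(G/(k\mathbb{Z})^n)$. The (twisted conjugacy) quotient growth function is $f_Q(k)=R(\overline{\varphi}_k)$,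 for positive integers $k$. For $g\in G$, $\tau_g:G\to G:h\mapsto ghg^{-1}$. $N$ is written additively in $\operatorname{Id}_N-\tau_g\circ\varphi|_N\in\operatorname{End}(N)$, and the rank of an endomorphism of $N$ is the rank of its image; $\operatorname{Id}_N-\tau_g\circ\varphi|_N$ depends only on the coset $gN$. For non-negative functions $f,g$ on the positive integers, $f(k)=\Theta(g(k))$ as $k\to\infty$ means that there are $c_1,c_2>0$ and $n_0\in\mathbb{N}_{>0}$ such that $c_1g(k)\le f(k)\le c_2g(k)$ for all integers $k\ge n_0$. *)

theory Defs
  imports "HOL-Algebra.Algebra" "HOL-Library.Landau_Symbols"
begin

definition virtually_abelian :: "('a, 'b) monoid_scheme \<Rightarrow> bool" where
  "virtually_abelian G \<longleftrightarrow>
     (\<exists>H. subgroup H G \<and> finite (rcosets\<^bsub>G\<^esub> H) \<and> comm_group (G\<lparr>carrier := H\<rparr>))"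

definition torsion_free :: "('a, 'b) monoid_scheme \<Rightarrow> bool" where
  "torsion_free G \<longleftrightarrow>
     (\<forall>x\<in>carrier G. \<forall>n::nat. n > 0 \<longrightarrow> x [^]\<^bsub>G\<^esub> n = \<one>\<^bsub>G\<^esub> \<longrightarrow> x = \<one>\<^bsub>G\<^esub>)"

definition word_length :: "('a, 'b) monoid_scheme \<Rightarrow> 'a set \<Rightarrow> 'a \<Rightarrow> nat" where
  "word_length G S g =
     (LEAST k. \<exists>ws. length ws = k \<and> set ws \<subseteq> S \<union> (\<lambda>s. inv\<^bsub>G\<^esub> s) ` S \<and>
                    foldr (\<lambda>s t. s \<otimes>\<^bsub>G\<^esub> t) ws \<one>\<^bsub>G\<^esub> = g)"

definition word_ball :: "('a, 'b) monoid_scheme \<Rightarrow> 'a set \<Rightarrow> nat \<Rightarrow> 'a set" where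
  "word_ball G S r = {g \<in> carrier G. word_length G S g \<le> r}"

definition twisted_conj :: "('a, 'b) monoid_scheme \<Rightarrow> ('a \<Rightarrow> 'a) \<Rightarrow> ('a \<times> 'a) set" where
  "twisted_conj H \<psi> =
     {(g, h). g \<in> carrier H \<and> h \<in> carrier H \<and>
              (\<exists>z\<in>carrier H. g = z \<otimes>\<^bsub>H\<^esub> h \<otimes>\<^bsub>H\<^esub> inv\<^bsub>H\<^esub> (\<psi> z))}"

definition twisted_class :: "('a, 'b) monoid_scheme \<Rightarrow> ('a \<Rightarrow> 'a) \<Rightarrow> 'a \<Rightarrow> 'a set" where
  "twisted_class H \<psi> g = twisted_conj H \<psi> `` {g}"

(* A natural number: only meaningful when there are finitely many classes
   (an infinite number of classes would give 0).  For k > 0 it is applied to finite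
   groups in quotient_growth; the value at k = 0 plays no role asymptotically. *)
definition reidemeister_number :: "('a, 'b) monoid_scheme \<Rightarrow> ('a \<Rightarrow> 'a) \<Rightarrow> nat" where
  "reidemeister_number H \<psi> = card (carrier H // twisted_conj H \<psi>)"

definition twisted_growth ::
    "('a, 'b) monoid_scheme \<Rightarrow> 'a set \<Rightarrow> ('a \<Rightarrow> 'a) \<Rightarrow> nat \<Rightarrow> nat" where
  "twisted_growth G S \<phi> r = card (twisted_class G \<phi> ` word_ball G S r)"

definition power_subgroup :: "('a, 'b) monoid_scheme \<Rightarrow> 'a set \<Rightarrow> nat \<Rightarrow> 'a set" where
  "power_subgroup G N k = {x [^]\<^bsub>G\<^esub> k | x. x \<in> N}"

(* The induced map sends the coset K #> g to K #> \<phi> g; the image below is a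
   singleton when K is normal, \<phi> is an endomorphism and \<phi> maps K into K. *)
definition induced_map ::
    "('a, 'b) monoid_scheme \<Rightarrow> 'a set \<Rightarrow> ('a \<Rightarrow> 'a) \<Rightarrow> 'a set \<Rightarrow> 'a set" where
  "induced_map G K \<phi> C = the_elem ((\<lambda>x. K #>\<^bsub>G\<^esub> \<phi> x) ` C)"

definition quotient_growth ::
    "('a, 'b) monoid_scheme \<Rightarrow> 'a set \<Rightarrow> ('a \<Rightarrow> 'a) \<Rightarrow> nat \<Rightarrow> nat" where
  "quotient_growth G N \<phi> k =
     reidemeister_number (G Mod power_subgroup G N k) (induced_map G (power_subgroup G N k) \<phi>)"

(* The n with A isomorphic to Z^n.  It exists for every finitely generated
   torsion-free abelian group and is unique by isomorphic_free_Abelian_groups. *)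
definition free_rank :: "('a, 'b) monoid_scheme \<Rightarrow> nat" where
  "free_rank A = (THE n::nat. A \<cong> free_Abelian_group {..<n})"

definition conj_map :: "('a, 'b) monoid_scheme \<Rightarrow> 'a \<Rightarrow> 'a \<Rightarrow> 'a" where
  "conj_map G g h = g \<otimes>\<^bsub>G\<^esub> h \<otimes>\<^bsub>G\<^esub> inv\<^bsub>G\<^esub> g"

(* Id - conj_map g o \<phi>, in multiplicative notation. *)
definition id_minus_twist ::
    "('a, 'b) monoid_scheme \<Rightarrow> ('a \<Rightarrow> 'a) \<Rightarrow> 'a \<Rightarrow> 'a \<Rightarrow> 'a" where
  "id_minus_twist G \<phi> g x = x \<otimes>\<^bsub>G\<^esub> inv\<^bsub>G\<^esub> ((conj_map G g \<circ> \<phi>) x)"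

definition endo_rank :: "('a, 'b) monoid_scheme \<Rightarrow> 'a set \<Rightarrow> ('a \<Rightarrow> 'a) \<Rightarrow> nat" where
  "endo_rank G N f = free_rank (G\<lparr>carrier := f ` N\<rparr>)"

(* All representatives g of a coset C of N give the same rank (N being abelian),
   so the inner image is a singleton. *)
definition coset_rank ::
    "('a, 'b) monoid_scheme \<Rightarrow> 'a set \<Rightarrow> ('a \<Rightarrow> 'a) \<Rightarrow> 'a set \<Rightarrow> nat" where
  "coset_rank G N \<phi> C = the_elem ((\<lambda>g. endo_rank G N (id_minus_twist G \<phi> g)) ` C)"

(* The subtraction on nat does not truncate: each image is a subgroup of N. *)
definition growth_exponent ::
    "('a, 'b) monoid_scheme \<Rightarrow> 'a set \<Rightarrow> ('a \<Rightarrow> 'a) \<Rightarrow> nat" where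
  "growth_exponent G N \<phi> =
     free_rank (G\<lparr>carrier := N\<rparr>) - Min (coset_rank G N \<phi> ` carrier (G Mod N))"

end

theory Submission
  imports Defs
begin

text \<open>
  Write \<open>I\<^sub>g\<close> for the image of \<open>D\<^sub>g = Id - \<tau>\<^sub>g \<circ> \<phi>\<close> on \<open>N\<close>. For \<open>x\<close> and \<open>z\<close> in \<open>N\<close> one has
  \<open>z (x g) \<phi>(z)\<inverse> = D\<^sub>g(z) x g\<close>, so twisting by elements of \<open>N\<close> identifies \<open>x g\<close> with \<open>y g\<close> exactly
  when \<open>x\<close> and \<open>y\<close> agree modulo \<open>I\<^sub>g\<close>. A full twisted class meets \<open>N g\<close> in at most \<open>[G : N]\<close> of
  these finer classes, one for each coset of \<open>N\<close> that can contain the conjugating element. Hence, up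
  to a bounded factor, the classes meeting a set \<open>A g\<close> are counted by the image of \<open>A\<close> in \<open>N / I\<^sub>g\<close>;
  working modulo \<open>N\<^sup>k\<close> replaces \<open>I\<^sub>g\<close> by \<open>I\<^sub>g N\<^sup>k\<close>. Lemma \<open>twisted_classes_coset_bounds\<close> proves both
  cases together.

  It remains to see that \<open>N / I\<^sub>g N\<^sup>k\<close>, and the part of \<open>N / I\<^sub>g\<close> met by the ball of radius \<open>k\<close>, have
  size of order \<open>k\<^sup>d\<close> with \<open>d = rank N - rank I\<^sub>g\<close>. The structure theorem for \<open>N / I\<^sub>g\<close> is avoided by
  taking a maximal set \<open>E\<close> of generators of \<open>N\<close> that is independent modulo \<open>I\<^sub>g\<close>; some power \<open>M\<close> maps
  \<open>N\<close> into \<open>\<langle>E\<rangle> I\<^sub>g\<close> (\<open>quasi_basis\<close>). Dividing exponents by \<open>M\<close> with remainder writes every element,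
  modulo \<open>I\<^sub>g\<close>, as one of finitely many remainders times a combination of \<open>E\<close>, whose exponents grow
  linearly with the length of the element and may be reduced modulo \<open>k\<close> in the presence of \<open>N\<^sup>k\<close>:
  these are the upper bounds. Combinations of \<open>E\<close> with exponents in \<open>[0, k/M)\<close> stay distinct modulo
  \<open>I\<^sub>g N\<^sup>k\<close>: this gives the lower bounds.

  The size of \<open>E\<close> is the difference of the ranks because \<open>E\<close> together with a basis of \<open>I\<^sub>g\<close> is a
  quasi-basis of \<open>N\<close> modulo the trivial group, and the index of \<open>N\<^sup>k\<close> in \<open>N\<close>, which grows like
  \<open>k ^ card E\<close> for every such \<open>E\<close>, shows that these all have the same size (\<open>quasi_basis_rank\<close>). Word length in \<open>G\<close> is compared
  with exponents in \<open>N\<close> through Schreier generators (\<open>schreier\<close>). Finally, both growth functions are,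
  up to a bounded factor, sums over the finitely many cosets of \<open>N\<close>, so the largest exponent, which
  belongs to the smallest rank of \<open>D\<^sub>g\<close>, determines the order of growth.
\<close>

section \<open>Integer combinations and quasi-bases in abelian groups\<close>

definition lincomb :: "('a, 'b) monoid_scheme \<Rightarrow> 'a set \<Rightarrow> ('a \<Rightarrow> int) \<Rightarrow> 'a" where
  "lincomb G E a = finprod G (\<lambda>x. x [^]\<^bsub>G\<^esub> a x) E"

definition indep_mod :: "('a, 'b) monoid_scheme \<Rightarrow> 'a set \<Rightarrow> 'a set \<Rightarrow> bool" where
  "indep_mod G L E \<longleftrightarrow> (\<forall>a. lincomb G E a \<in> L \<longrightarrow> (\<forall>x\<in>E. a x = 0))"

text \<open>
  Modulo \<open>L\<close>, the set \<open>E\<close> is a basis of a free abelian subgroup that contains all \<open>M\<close>-th powers.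
  Allowing for \<open>M\<close> makes it possible to choose \<open>E\<close> among given generators, and the torsion of the
  quotient by \<open>L\<close> never has to be split off.
\<close>

definition quasi_basis :: "('a, 'b) monoid_scheme \<Rightarrow> 'a set \<Rightarrow> 'a set \<Rightarrow> int \<Rightarrow> bool" where
  "quasi_basis G L E M \<longleftrightarrow>
     finite E \<and> E \<subseteq> carrier G \<and> indep_mod G L E \<and> M > 0 \<and>
     (\<forall>x\<in>carrier G. \<exists>b. \<exists>l\<in>L. x [^]\<^bsub>G\<^esub> M = lincomb G E b \<otimes>\<^bsub>G\<^esub> l)"

context comm_group
begin

lemma lincomb_closed [simp, intro]:
  "E \<subseteq> carrier G \<Longrightarrow> lincomb G E a \<in> carrier G"
  unfolding lincomb_def by (rule finprod_closed) auto

lemma lincomb_cong: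
  assumes "E \<subseteq> carrier G" "\<And>x. x \<in> E \<Longrightarrow> a x = b x"
  shows "lincomb G E a = lincomb G E b"
  unfolding lincomb_def by (rule finprod_cong') (use assms in auto)

lemma lincomb_insert:
  assumes "finite E" "t \<notin> E" "insert t E \<subseteq> carrier G"
  shows "lincomb G (insert t E) a = t [^] a t \<otimes> lincomb G E a"
  unfolding lincomb_def by (rule finprod_insert) (use assms in auto)

lemma lincomb_Un_disjoint:
  assumes "finite E" "finite F" "E \<inter> F = {}" "E \<subseteq> carrier G" "F \<subseteq> carrier G"
  shows "lincomb G (E \<union> F) a = lincomb G E a \<otimes> lincomb G F a"
  unfolding lincomb_def by (rule finprod_Un_disjoint) (use assms in auto)

lemma lincomb_add:
  assumes "E \<subseteq> carrier G"
  shows "lincomb G E (\<lambda>x. a x + b x) = lincomb G E a \<otimes> lincomb G E b"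
proof -
  have "lincomb G E (\<lambda>x. a x + b x) = finprod G (\<lambda>x. x [^] a x \<otimes> x [^] b x) E"
    unfolding lincomb_def by (rule finprod_cong') (use assms int_pow_mult in auto)
  also have "\<dots> = lincomb G E a \<otimes> lincomb G E b"
    unfolding lincomb_def by (rule finprod_multf) (use assms in auto)
  finally show ?thesis .
qed

lemma lincomb_zero [simp]: "lincomb G E (\<lambda>_. 0) = \<one>"
  unfolding lincomb_def by (simp add: finprod_one)

lemma lincomb_empty [simp]: "lincomb G {} a = \<one>"
  unfolding lincomb_def by simp

lemma lincomb_cmul:
  assumes "finite E" "E \<subseteq> carrier G"
  shows "lincomb G E (\<lambda>x. k * a x) = lincomb G E a [^] k"
  using assms
proof (induction E)
  case (insert t E)
  have "lincomb G (insert t E) (\<lambda>x. k * a x) = t [^] (k * a t) \<otimes> lincomb G E a [^] k"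
    using insert by (subst lincomb_insert) auto
  also have "t [^] (k * a t) = (t [^] a t) [^] k"
    using insert.prems by (simp add: int_pow_pow mult.commute)
  finally show ?case
    using insert by (simp add: lincomb_insert int_pow_distrib)
qed simp

lemma lincomb_uminus:
  assumes "finite E" "E \<subseteq> carrier G"
  shows "lincomb G E (\<lambda>x. - a x) = inv (lincomb G E a)"
  using lincomb_cmul[OF assms, of "-1" a] assms by (simp add: int_pow_neg)

lemma lincomb_diff:
  assumes "finite E" "E \<subseteq> carrier G"
  shows "lincomb G E (\<lambda>x. a x - b x) = lincomb G E a \<otimes> inv (lincomb G E b)"
  using lincomb_add[of E a "\<lambda>x. - b x"] lincomb_uminus[OF assms, of b] assms by simp

lemma lincomb_delta:
  assumes "finite E" "E \<subseteq> carrier G" "t \<in> E"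
  shows "lincomb G E (\<lambda>x. if x = t then k else 0) = t [^] k"
proof -
  have "lincomb G E (\<lambda>x. if x = t then k else 0)
      = lincomb G (insert t (E - {t})) (\<lambda>x. if x = t then k else 0)"
    using assms by (simp add: insert_absorb)
  also have "\<dots> = t [^] k \<otimes> lincomb G (E - {t}) (\<lambda>x. if x = t then k else 0)"
    using assms by (subst lincomb_insert) auto
  also have "lincomb G (E - {t}) (\<lambda>x. if x = t then k else 0) = lincomb G (E - {t}) (\<lambda>_. 0)"
    using assms by (intro lincomb_cong) auto
  finally show ?thesis using assms by auto
qed

lemma lincomb_in_subgroup:
  assumes "subgroup H G" "finite E" "E \<subseteq> H"
  shows "lincomb G E a \<in> H"
  using assms(2,3)
proof (induction E)
  case empty
  then show ?case using assms(1) by (simp add: subgroup.one_closed)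
next
  case (insert t E)
  moreover have "insert t E \<subseteq> carrier G"
    using insert.prems subgroup.subset[OF assms(1)] by blast
  ultimately show ?case
    using assms(1) by (simp add: lincomb_insert subgroup.m_closed subgroup_int_pow_closed)
qed

lemma subgroup_range_lincomb:
  assumes "finite E" "E \<subseteq> carrier G"
  shows "subgroup (range (lincomb G E)) G"
proof
  show "range (lincomb G E) \<subseteq> carrier G" using assms by auto
  show "x \<otimes> y \<in> range (lincomb G E)"
    if "x \<in> range (lincomb G E)" "y \<in> range (lincomb G E)" for x y
    using that assms(2) by (auto simp flip: lincomb_add)
  show "\<one> \<in> range (lincomb G E)" by (metis lincomb_zero rangeI)
  show "inv x \<in> range (lincomb G E)" if "x \<in> range (lincomb G E)" for x
    using that assms by (auto simp flip: lincomb_uminus)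
qed

lemma generate_eq_range_lincomb:
  assumes "finite E" "E \<subseteq> carrier G"
  shows "generate G E = range (lincomb G E)"
proof
  have "E \<subseteq> range (lincomb G E)"
    using lincomb_delta[OF assms, of _ 1] assms(2)
    by (metis (no_types, lifting) int_pow_1 rangeI subset_eq)
  then show "generate G E \<subseteq> range (lincomb G E)"
    using generate_subgroup_incl subgroup_range_lincomb[OF assms] by blast
  show "range (lincomb G E) \<subseteq> generate G E"
    using lincomb_in_subgroup[OF generate_is_subgroup[OF assms(2)] assms(1)] generate.incl
    by fastforce
qed

text \<open>
  A maximal independent subset of the generators works: by maximality, each further generator
  satisfies a relation in which its own exponent is nonzero, so one of its powers lies in \<open>\<langle>E\<rangle> L\<close>.
  The product of these exponents serves all generators at once.
\<close>

lemma quasi_basis_ex: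
  assumes "finite T" "T \<subseteq> carrier G" "generate G T = carrier G" and L: "subgroup L G"
  shows "\<exists>E M. quasi_basis G L E M"
proof -
  interpret L: subgroup L G by fact
  define P where "P E \<longleftrightarrow> E \<subseteq> T \<and> indep_mod G L E" for E
  have "P {}" by (simp add: P_def indep_mod_def)
  moreover have "finite {E. P E}"
    using assms(1) by (auto simp: P_def intro: finite_subset[of _ "Pow T"])
  ultimately obtain E where "P E" and max: "\<And>F. P F \<Longrightarrow> E \<subseteq> F \<Longrightarrow> E = F"
    using finite_has_maximal[of "{E. P E}"] by blast
  then have ET: "E \<subseteq> T" and ind: "indep_mod G L E" by (auto simp: P_def)
  have finE: "finite E" and E: "E \<subseteq> carrier G" using ET assms finite_subset by auto
  define H where "H = range (lincomb G E) <#> L"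
  have H: "subgroup H G"
    unfolding H_def by (rule mult_subgroups[OF subgroup_range_lincomb[OF finE E] L])
  have pow: "\<exists>m::int. m > 0 \<and> t [^] m \<in> H" if t: "t \<in> T" for t
  proof (cases "t \<in> E")
    case True
    have "t [^] (1::int) = lincomb G E (\<lambda>x. if x = t then 1 else 0) \<otimes> \<one>"
      using lincomb_delta[OF finE E True, of 1] E True by auto
    then have "t [^] (1::int) \<in> H"
      unfolding H_def set_mult_def using L.one_closed by blast
    then show ?thesis by (intro exI[of _ 1]) simp
  next
    case False
    have tc: "t \<in> carrier G" using t assms by auto
    have "\<not> P (insert t E)" using max False by blast
    then obtain a x where a: "lincomb G (insert t E) a \<in> L" "x \<in> insert t E" "a x \<noteq> 0"
      using t ET by (auto simp: P_def indep_mod_def)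
    have eq: "lincomb G (insert t E) a = t [^] a t \<otimes> lincomb G E a"
      using lincomb_insert finE False E tc by simp
    have at: "a t \<noteq> 0"
    proof
      assume "a t = 0"
      then have "lincomb G E a \<in> L" using a(1) eq E by simp
      then show False using ind a \<open>a t = 0\<close> unfolding indep_mod_def by auto
    qed
    have "t [^] a t = lincomb G E (\<lambda>x. - a x) \<otimes> lincomb G (insert t E) a"
      using eq finE E tc
      by (metis int_pow_closed inv_solve_left' lincomb_closed lincomb_uminus m_closed m_comm inv_closed)
    then have "t [^] a t \<in> H"
      unfolding H_def set_mult_def using a(1) by blast
    moreover from this have "t [^] (- a t) \<in> H"
      using H tc by (simp add: int_pow_neg subgroup.m_inv_closed)
    ultimately show ?thesis
      using at by (cases "a t > 0") (auto intro: exI[of _ "a t"] exI[of _ "- a t"])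
  qed
  then obtain m where m: "\<And>t. t \<in> T \<Longrightarrow> (m t :: int) > 0 \<and> t [^] m t \<in> H" by metis
  define M where "M = prod m T"
  have M: "M > 0" unfolding M_def using m by (simp add: prod_pos)
  have sub: "subgroup {x \<in> carrier G. x [^] M \<in> H} G"
  proof
    show "\<one> \<in> {x \<in> carrier G. x [^] M \<in> H}" using H subgroup.one_closed by auto
  qed (use H in \<open>auto simp: int_pow_distrib int_pow_inv subgroup.m_closed subgroup.m_inv_closed\<close>)
  have T_sub: "T \<subseteq> {x \<in> carrier G. x [^] M \<in> H}"
  proof
    fix t assume t: "t \<in> T"
    then obtain q where "M = m t * q"
      unfolding M_def using assms(1) by (metis dvd_def dvd_prodI)
    then have "t [^] M = (t [^] m t) [^] q"
      using t assms(2) by (auto simp: int_pow_pow)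
    then show "t \<in> {x \<in> carrier G. x [^] M \<in> H}"
      using subgroup_int_pow_closed[OF H] m t assms(2) by auto
  qed
  have "carrier G \<subseteq> {x \<in> carrier G. x [^] M \<in> H}"
    using generate_subgroup_incl[OF T_sub sub] assms(3) by simp
  then have "\<forall>x\<in>carrier G. \<exists>b. \<exists>l\<in>L. x [^] M = lincomb G E b \<otimes> l"
    unfolding H_def set_mult_def by blast
  then show ?thesis
    unfolding quasi_basis_def using finE E ind M by blast
qed

text \<open>
  The exponents with respect to \<open>E\<close> depend linearly on those with respect to \<open>T\<close>; the constant \<open>D\<close>
  is the total size of the coefficients that express the powers \<open>t\<^sup>M\<close>.
\<close>

lemma quasi_basis_pow_bounded:
  assumes qb: "quasi_basis G L E M" and L: "subgroup L G"
    and "finite T" "T \<subseteq> carrier G"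
  shows "\<exists>D::nat. \<forall>r::nat. \<forall>q. (\<forall>t\<in>T. \<bar>q t\<bar> \<le> int r) \<longrightarrow>
           (\<exists>b. (\<forall>e\<in>E. \<bar>b e\<bar> \<le> int (D * r)) \<and>
                (\<exists>l\<in>L. lincomb G T q [^] M = lincomb G E b \<otimes> l))"
  using assms(3,4)
proof (induction T)
  case empty
  have "\<exists>l\<in>L. lincomb G {} q [^] M = lincomb G E (\<lambda>_. 0) \<otimes> l" for q
    using subgroup.one_closed[OF L] by (intro bexI[of _ \<one>]) auto
  then show ?case
    by (intro exI[of _ 0] allI impI exI[of _ "\<lambda>_. 0"] conjI) auto
next
  case (insert t T)
  interpret L: subgroup L G by fact
  have finE: "finite E" and E: "E \<subseteq> carrier G" using qb by (auto simp: quasi_basis_def)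
  obtain D where D: "\<And>r q. (\<forall>t\<in>T. \<bar>q t\<bar> \<le> int r) \<Longrightarrow>
           (\<exists>b. (\<forall>e\<in>E. \<bar>b e\<bar> \<le> int (D * r)) \<and>
                (\<exists>l\<in>L. lincomb G T q [^] M = lincomb G E b \<otimes> l))"
    using insert by (metis insert_subset)
  obtain c l0 where c: "l0 \<in> L" "t [^] M = lincomb G E c \<otimes> l0"
    using qb insert.prems unfolding quasi_basis_def by blast
  define C where "C = nat (\<Sum>e\<in>E. \<bar>c e\<bar>)"
  have cC: "\<bar>c e\<bar> \<le> int C" if "e \<in> E" for e
    using member_le_sum[of e E "\<lambda>e. \<bar>c e\<bar>"] that finE by (simp add: C_def sum_nonneg)
  show ?case
  proof (intro exI[of _ "D + C"] allI impI)
    fix r :: nat and q assume q: "\<forall>u\<in>insert t T. \<bar>q u\<bar> \<le> int r"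
    then obtain b l where b: "\<forall>e\<in>E. \<bar>b e\<bar> \<le> int (D * r)" "l \<in> L"
        "lincomb G T q [^] M = lincomb G E b \<otimes> l"
      using D[of q r] by auto
    have "lincomb G (insert t T) q [^] M = (t [^] M) [^] q t \<otimes> lincomb G T q [^] M"
      using insert by (simp add: lincomb_insert int_pow_distrib int_pow_pow mult.commute)
    also have "(t [^] M) [^] q t = lincomb G E (\<lambda>e. q t * c e) \<otimes> l0 [^] q t"
      using c finE E by (simp add: int_pow_distrib lincomb_cmul)
    also have "\<dots> \<otimes> lincomb G T q [^] M
        = lincomb G E (\<lambda>e. q t * c e + b e) \<otimes> (l0 [^] q t \<otimes> l)"
      using b(2,3) c(1) E by (simp add: lincomb_add m_ac)
    finally have eq: "lincomb G (insert t T) q [^] M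
        = lincomb G E (\<lambda>e. q t * c e + b e) \<otimes> (l0 [^] q t \<otimes> l)" .
    have "\<bar>q t * c e + b e\<bar> \<le> int ((D + C) * r)" if e: "e \<in> E" for e
    proof -
      have "\<bar>q t * c e + b e\<bar> \<le> \<bar>q t\<bar> * \<bar>c e\<bar> + \<bar>b e\<bar>"
        using abs_triangle_ineq[of "q t * c e" "b e"] by (simp add: abs_mult)
      also have "\<bar>q t\<bar> * \<bar>c e\<bar> \<le> int r * int C"
        using q cC[OF e] by (intro mult_mono) auto
      finally show ?thesis using b(1) e by (auto simp: algebra_simps)
    qed
    moreover have "l0 [^] q t \<otimes> l \<in> L"
      using subgroup_int_pow_closed[OF L c(1)] b(2) by auto
    ultimately show "\<exists>b. (\<forall>e\<in>E. \<bar>b e\<bar> \<le> int ((D + C) * r)) \<and>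
        (\<exists>l\<in>L. lincomb G (insert t T) q [^] M = lincomb G E b \<otimes> l)"
      using eq by (intro exI[of _ "\<lambda>e. q t * c e + b e"] conjI ballI
          bexI[of _ "l0 [^] q t \<otimes> l"])
  qed
qed

text \<open>
  Division with remainder by \<open>M\<close>: the first factor ranges over a finite set that is independent of
  \<open>r\<close>, and the quotients are handled by the preceding lemma.
\<close>

lemma quasi_basis_decomposition:
  assumes qb: "quasi_basis G L E M" and L: "subgroup L G"
    and T: "finite T" "T \<subseteq> carrier G"
  shows "\<exists>D::nat. \<forall>r::nat. \<forall>a. (\<forall>t\<in>T. \<bar>a t\<bar> \<le> int r) \<longrightarrow>
           (\<exists>b. (\<forall>e\<in>E. \<bar>b e\<bar> \<le> int (D * r)) \<and>
                (\<exists>l\<in>L. lincomb G T a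
                   = lincomb G T (\<lambda>t. a t mod M) \<otimes> (lincomb G E b \<otimes> l)))"
proof -
  obtain D where D: "\<forall>r q. (\<forall>t\<in>T. \<bar>q t\<bar> \<le> int r) \<longrightarrow>
           (\<exists>b. (\<forall>e\<in>E. \<bar>b e\<bar> \<le> int (D * r)) \<and>
                (\<exists>l\<in>L. lincomb G T q [^] M = lincomb G E b \<otimes> l))"
    using quasi_basis_pow_bounded[OF assms] ..
  have M: "M > 0" using qb by (simp add: quasi_basis_def)
  show ?thesis
  proof (intro exI[of _ D] allI impI)
    fix r :: nat and a assume a: "\<forall>t\<in>T. \<bar>a t\<bar> \<le> int r"
    have "\<bar>a t div M\<bar> \<le> int r" if "t \<in> T" for t
    proof -
      have "\<bar>x div M\<bar> \<le> \<bar>x\<bar>" for x :: int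
      proof (cases "x \<ge> 0")
        case True
        then have "x div M \<le> x div 1" using M by (intro zdiv_mono2) auto
        then show ?thesis using M True by (simp add: pos_imp_zdiv_nonneg_iff)
      next
        case False
        have "x * M \<le> x * 1" using False M by (intro mult_left_mono_neg) auto
        then have "x * M div M \<le> x div M" using M by (intro zdiv_mono1) auto
        then have "x \<le> x div M" using M by simp
        moreover have "x div M < 0" using False M by (simp add: pos_imp_zdiv_neg_iff)
        ultimately show ?thesis by simp
      qed
      then show ?thesis using a that order_trans by blast
    qed
    then obtain b l where b: "\<forall>e\<in>E. \<bar>b e\<bar> \<le> int (D * r)" "l \<in> L"
        "lincomb G T (\<lambda>t. a t div M) [^] M = lincomb G E b \<otimes> l"
      using D[rule_format, of "\<lambda>t. a t div M" r] by auto
    have "lincomb G T a = lincomb G T (\<lambda>t. a t mod M + M * (a t div M))" by simp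
    also have "\<dots> = lincomb G T (\<lambda>t. a t mod M) \<otimes> lincomb G T (\<lambda>t. a t div M) [^] M"
      using T by (simp only: lincomb_add lincomb_cmul)
    finally show "\<exists>b. (\<forall>e\<in>E. \<bar>b e\<bar> \<le> int (D * r)) \<and>
        (\<exists>l\<in>L. lincomb G T a = lincomb G T (\<lambda>t. a t mod M) \<otimes> (lincomb G E b \<otimes> l))"
      using b by auto
  qed
qed

end

section \<open>Counting cosets of subgroups of abelian groups\<close>

context comm_group
begin

text \<open>
  The coset of \<open>lincomb G T a\<close> is determined by the remainders of \<open>a\<close> modulo \<open>M\<close> and by exponents of
  the elements of \<open>E\<close> in an interval of length proportional to \<open>r\<close>.
\<close>

lemma card_rcosets_box_le:
  assumes qb: "quasi_basis G L E M" and L: "subgroup L G"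
    and T: "finite T" "T \<subseteq> carrier G"
  shows "\<exists>C::nat. \<forall>r\<ge>1.
           finite ((\<lambda>a. L #> lincomb G T a) ` {a. \<forall>t\<in>T. \<bar>a t\<bar> \<le> int r}) \<and>
           card ((\<lambda>a. L #> lincomb G T a) ` {a. \<forall>t\<in>T. \<bar>a t\<bar> \<le> int r}) \<le> C * r ^ card E"
proof -
  interpret L: subgroup L G by fact
  have E: "finite E" "E \<subseteq> carrier G" and M: "M > 0" using qb by (auto simp: quasi_basis_def)
  obtain D where D: "\<forall>r::nat. \<forall>a. (\<forall>t\<in>T. \<bar>a t\<bar> \<le> int r) \<longrightarrow>
           (\<exists>b. (\<forall>e\<in>E. \<bar>b e\<bar> \<le> int (D * r)) \<and>
                (\<exists>l\<in>L. lincomb G T a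
                   = lincomb G T (\<lambda>t. a t mod M) \<otimes> (lincomb G E b \<otimes> l)))"
    using quasi_basis_decomposition[OF assms] ..
  show ?thesis
  proof (intro exI[of _ "nat M ^ card T * (2 * D + 1) ^ card E"] allI impI)
    fix r :: nat assume r: "r \<ge> 1"
    let ?A = "(\<lambda>a. L #> lincomb G T a) ` {a. \<forall>t\<in>T. \<bar>a t\<bar> \<le> int r}"
    define Z where "Z = (T \<rightarrow>\<^sub>E {0..<M}) \<times> (E \<rightarrow>\<^sub>E {- int (D * r)..int (D * r)})"
    have finZ: "finite Z" unfolding Z_def using T E by (intro finite_SigmaI finite_PiE) auto
    have sub: "?A \<subseteq> (\<lambda>(v, b). L #> (lincomb G T v \<otimes> lincomb G E b)) ` Z"
    proof safe
      fix a assume "\<forall>t\<in>T. \<bar>a t\<bar> \<le> int r"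
      then obtain b l where b: "\<forall>e\<in>E. \<bar>b e\<bar> \<le> int (D * r)" "l \<in> L"
          "lincomb G T a = lincomb G T (\<lambda>t. a t mod M) \<otimes> (lincomb G E b \<otimes> l)"
        using D by blast
      let ?v = "restrict (\<lambda>t. a t mod M) T" and ?b = "restrict b E"
      have "lincomb G T (\<lambda>t. a t mod M) = lincomb G T ?v" "lincomb G E b = lincomb G E ?b"
        using T E by (auto intro!: lincomb_cong)
      then have "lincomb G T a = l \<otimes> (lincomb G T ?v \<otimes> lincomb G E ?b)"
        using b T E by (simp add: m_ac)
      then have "lincomb G T a \<in> L #> (lincomb G T ?v \<otimes> lincomb G E ?b)"
        using b(2) unfolding r_coset_def by blast
      then have e: "L #> (lincomb G T ?v \<otimes> lincomb G E ?b) = L #> lincomb G T a"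
        using L T E by (intro repr_independence) auto
      have m: "(?v, ?b) \<in> Z"
        using b(1) M by (auto simp: Z_def abs_le_iff minus_le_iff)
      show "L #> lincomb G T a
          \<in> (\<lambda>(v, b). L #> (lincomb G T v \<otimes> lincomb G E b)) ` Z"
        by (rule image_eqI[OF _ m]) (simp only: prod.case e)
    qed
    have "card {- int q..int q} = 2 * q + 1" for q by simp
    then have "card Z = nat M ^ card T * (2 * (D * r) + 1) ^ card E"
      unfolding Z_def using T E
      by (simp add: card_cartesian_product card_PiE del: card_atLeastAtMost_int of_nat_mult)
    also have "2 * (D * r) + 1 \<le> (2 * D + 1) * r"
      using r by (simp add: algebra_simps)
    then have "nat M ^ card T * (2 * (D * r) + 1) ^ card E
        \<le> nat M ^ card T * ((2 * D + 1) * r) ^ card E"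
      by (intro mult_left_mono power_mono) auto
    also have "\<dots> = nat M ^ card T * (2 * D + 1) ^ card E * r ^ card E"
      by (simp only: power_mult_distrib mult.assoc)
    finally have "card Z \<le> nat M ^ card T * (2 * D + 1) ^ card E * r ^ card E" .
    moreover have "card ?A \<le> card Z"
      using card_mono[OF _ sub] card_image_le[OF finZ] finZ by (meson finite_imageI le_trans)
    ultimately show "finite ?A \<and> card ?A \<le> nat M ^ card T * (2 * D + 1) ^ card E * r ^ card E"
      using finite_subset[OF sub] finZ by auto
  qed
qed

text \<open>
  As soon as \<open>L'\<close> contains all \<open>k\<close>-th powers, the exponents of the elements of \<open>E\<close> matter only modulo
  \<open>k\<close>, so every element of the group is covered and no length bound is involved. The constant does
  not depend on \<open>k\<close> or \<open>L'\<close>.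
\<close>

lemma card_rcosets_mod_powers_le:
  assumes qb: "quasi_basis G L E M" and T: "finite T" "T \<subseteq> carrier G" "generate G T = carrier G"
    and L: "subgroup L G"
  shows "\<exists>C::nat. \<forall>k\<ge>1. \<forall>L'. subgroup L' G \<longrightarrow> L \<subseteq> L' \<longrightarrow> (\<forall>x\<in>carrier G. x [^] int k \<in> L') \<longrightarrow>
           finite ((\<lambda>x. L' #> x) ` carrier G) \<and>
           card ((\<lambda>x. L' #> x) ` carrier G) \<le> C * k ^ card E"
proof -
  interpret L: subgroup L G by fact
  have E: "finite E" "E \<subseteq> carrier G" and M: "M > 0" using qb by (auto simp: quasi_basis_def)
  obtain D where D: "\<forall>r::nat. \<forall>a. (\<forall>t\<in>T. \<bar>a t\<bar> \<le> int r) \<longrightarrow>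
           (\<exists>b. (\<forall>e\<in>E. \<bar>b e\<bar> \<le> int (D * r)) \<and>
                (\<exists>l\<in>L. lincomb G T a
                   = lincomb G T (\<lambda>t. a t mod M) \<otimes> (lincomb G E b \<otimes> l)))"
    using quasi_basis_decomposition[OF qb L T(1,2)] ..
  show ?thesis
  proof (intro exI[of _ "nat M ^ card T"] allI impI)
    fix k :: nat and L' assume k: "k \<ge> 1" and L': "subgroup L' G" and LL': "L \<subseteq> L'"
      and pow: "\<forall>x\<in>carrier G. x [^] int k \<in> L'"
    interpret L': subgroup L' G by fact
    let ?A = "(\<lambda>x. L' #> x) ` carrier G"
    define Z where "Z = (T \<rightarrow>\<^sub>E {0..<M}) \<times> (E \<rightarrow>\<^sub>E {0..<int k})"
    have finZ: "finite Z" unfolding Z_def using T E by (intro finite_SigmaI finite_PiE) auto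
    have sub: "?A \<subseteq> (\<lambda>(v, b). L' #> (lincomb G T v \<otimes> lincomb G E b)) ` Z"
    proof safe
      fix x assume x: "x \<in> carrier G"
      then obtain a where a: "x = lincomb G T a"
        using generate_eq_range_lincomb[OF T(1,2)] T(3) by auto
      define r where "r = nat (\<Sum>t\<in>T. \<bar>a t\<bar>)"
      have "\<bar>a t\<bar> \<le> int r" if "t \<in> T" for t
        using member_le_sum[of t T "\<lambda>t. \<bar>a t\<bar>"] that T by (simp add: r_def sum_nonneg)
      then obtain b l where b: "l \<in> L"
          "x = lincomb G T (\<lambda>t. a t mod M) \<otimes> (lincomb G E b \<otimes> l)"
        using D a by blast
      let ?v = "restrict (\<lambda>t. a t mod M) T" and ?b = "restrict (\<lambda>e. b e mod int k) E"
      have "lincomb G E b = lincomb G E (\<lambda>e. b e mod int k + int k * (b e div int k))" by simp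
      also have "\<dots> = lincomb G E (\<lambda>e. b e mod int k) \<otimes> lincomb G E (\<lambda>e. b e div int k) [^] int k"
        using E by (simp only: lincomb_add lincomb_cmul)
      finally have "lincomb G E b
          = lincomb G E (\<lambda>e. b e mod int k) \<otimes> lincomb G E (\<lambda>e. b e div int k) [^] int k" .
      moreover have "lincomb G T (\<lambda>t. a t mod M) = lincomb G T ?v"
          "lincomb G E (\<lambda>e. b e mod int k) = lincomb G E ?b"
        using T E by (auto intro!: lincomb_cong)
      ultimately have "x = (l \<otimes> lincomb G E (\<lambda>e. b e div int k) [^] int k)
          \<otimes> (lincomb G T ?v \<otimes> lincomb G E ?b)"
        using b T E by (simp add: m_ac)
      moreover have "l \<otimes> lincomb G E (\<lambda>e. b e div int k) [^] int k \<in> L'"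
        using b(1) LL' pow E by blast
      ultimately have "x \<in> L' #> (lincomb G T ?v \<otimes> lincomb G E ?b)"
        unfolding r_coset_def by blast
      then have e: "L' #> (lincomb G T ?v \<otimes> lincomb G E ?b) = L' #> x"
        using L' T E by (intro repr_independence) auto
      have m: "(?v, ?b) \<in> Z"
        using M k by (auto simp: Z_def)
      show "L' #> x \<in> (\<lambda>(v, b). L' #> (lincomb G T v \<otimes> lincomb G E b)) ` Z"
        by (rule image_eqI[OF _ m]) (simp only: prod.case e)
    qed
    have "card Z = nat M ^ card T * k ^ card E"
      unfolding Z_def using T E by (simp add: card_cartesian_product card_PiE)
    moreover have "card ?A \<le> card Z"
      using card_mono[OF _ sub] card_image_le[OF finZ] finZ by (meson finite_imageI le_trans)
    ultimately show "finite ?A \<and> card ?A \<le> nat M ^ card T * k ^ card E"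
      using finite_subset[OF sub] finZ by auto
  qed
qed

text \<open>
  Two exponent vectors in \<open>[0, p)\<close> differ by a vector with entries of absolute value below \<open>p\<close>; hence
  it suffices that \<open>L\<close> contains no nontrivial combination with such small exponents.
\<close>

lemma inj_on_rcoset_lincomb:
  assumes E: "finite E" "E \<subseteq> carrier G" and L: "subgroup L G"
    and small: "\<And>a. lincomb G E a \<in> L \<Longrightarrow> \<forall>e\<in>E. \<bar>a e\<bar> < int p \<Longrightarrow> \<forall>e\<in>E. a e = 0"
  shows "inj_on (\<lambda>b. L #> lincomb G E b) (E \<rightarrow>\<^sub>E {0..<int p})"
proof (rule inj_onI)
  interpret L: subgroup L G by fact
  fix b c assume b: "b \<in> E \<rightarrow>\<^sub>E {0..<int p}" and c: "c \<in> E \<rightarrow>\<^sub>E {0..<int p}"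
    and eq: "L #> lincomb G E b = L #> lincomb G E c"
  have "lincomb G E b \<in> L #> lincomb G E c"
    using eq rcos_self[OF _ L] E by auto
  then have "lincomb G E b \<otimes> inv lincomb G E c \<in> L"
    using L.rcos_module[OF is_group] E by auto
  then have "lincomb G E (\<lambda>e. b e - c e) \<in> L" using E by (simp add: lincomb_diff)
  moreover have "\<bar>b e - c e\<bar> < int p" if "e \<in> E" for e
    using PiE_mem[OF b that] PiE_mem[OF c that] by auto
  ultimately have "\<forall>e\<in>E. b e - c e = 0" by (intro small) auto
  then show "b = c" by (intro PiE_ext[OF b c]) simp
qed

text \<open>
  If a combination of \<open>E\<close> lies in \<open>G\<^sup>k L\<close>, raising it to the power \<open>M\<close> turns the \<open>k\<close>-th power into a
  combination of \<open>E\<close> with exponents divisible by \<open>k\<close>. By independence \<open>k\<close> divides every \<open>M * a e\<close>,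
  which is too small to be a nonzero multiple of \<open>k\<close>.
\<close>

lemma quasi_basis_small_mod_powers:
  assumes qb: "quasi_basis G L E M" and L: "subgroup L G"
    and k: "M * (int p - 1) < int k"
    and L': "\<And>x. x \<in> L' \<Longrightarrow> \<exists>y\<in>carrier G. \<exists>l\<in>L. x = y [^] int k \<otimes> l"
    and a: "lincomb G E a \<in> L'" "\<forall>e\<in>E. \<bar>a e\<bar> < int p"
  shows "\<forall>e\<in>E. a e = 0"
proof -
  interpret L: subgroup L G by fact
  have E: "finite E" "E \<subseteq> carrier G" and M: "M > 0" and ind: "indep_mod G L E"
    using qb by (auto simp: quasi_basis_def)
  obtain y l where y: "y \<in> carrier G" "l \<in> L" "lincomb G E a = y [^] int k \<otimes> l"
    using L' a(1) by blast
  obtain c l0 where c: "l0 \<in> L" "y [^] M = lincomb G E c \<otimes> l0"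
    using qb y(1) unfolding quasi_basis_def by blast
  have "lincomb G E (\<lambda>e. M * a e) = (y [^] M) [^] int k \<otimes> l [^] M"
    using y E by (simp add: lincomb_cmul int_pow_distrib int_pow_pow mult.commute)
  also have "(y [^] M) [^] int k = lincomb G E (\<lambda>e. int k * c e) \<otimes> l0 [^] int k"
    using c E by (simp only: lincomb_cmul int_pow_distrib lincomb_closed L.mem_carrier)
  finally have "lincomb G E (\<lambda>e. M * a e)
      = (l0 [^] int k \<otimes> l [^] M) \<otimes> lincomb G E (\<lambda>e. int k * c e)"
    using c(1) y(2) E by (simp add: m_ac)
  then have "lincomb G E (\<lambda>e. M * a e) \<otimes> inv (lincomb G E (\<lambda>e. int k * c e))
      = l0 [^] int k \<otimes> l [^] M"
    using c(1) y(2) E by (simp add: m_assoc)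
  then have "lincomb G E (\<lambda>e. M * a e - int k * c e) = l0 [^] int k \<otimes> l [^] M"
    using E by (simp only: lincomb_diff)
  also have "\<dots> \<in> L"
    using c(1) y(2) subgroup_int_pow_closed[OF L] by blast
  finally have zero: "\<forall>e\<in>E. M * a e - int k * c e = 0"
    using ind unfolding indep_mod_def by blast
  show ?thesis
  proof
    fix e assume e: "e \<in> E"
    have "M * \<bar>a e\<bar> \<le> M * (int p - 1)" using a(2) e M by (intro mult_left_mono) auto
    moreover have "\<bar>M * a e\<bar> = M * \<bar>a e\<bar>" using M by (simp add: abs_mult)
    ultimately have "\<bar>M * a e\<bar> < int k" using k by linarith
    moreover have "int k dvd M * a e" using zero e by auto
    ultimately have "M * a e = 0"
      using zdvd_not_zless[of "\<bar>M * a e\<bar>" "int k"] by (cases "M * a e = 0") auto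
    then show "a e = 0" using M by simp
  qed
qed

lemma power_le_card_rcosets_mod_powers:
  assumes qb: "quasi_basis G L E M" and L: "subgroup L G" and k: "k \<ge> 1"
    and L': "subgroup L' G"
      "\<And>x. x \<in> L' \<Longrightarrow> \<exists>y\<in>carrier G. \<exists>l\<in>L. x = y [^] int k \<otimes> l"
    and fin: "finite ((\<lambda>x. L' #> x) ` carrier G)"
  shows "k ^ card E \<le> nat M ^ card E * card ((\<lambda>x. L' #> x) ` carrier G)"
proof -
  have E: "finite E" "E \<subseteq> carrier G" and M: "M > 0" using qb by (auto simp: quasi_basis_def)
  \<comment> \<open>The largest \<open>p\<close> with \<open>M * (p - 1) < k\<close>; it satisfies \<open>k \<le> M * p\<close>.\<close>
  define p where "p = nat ((int k - 1) div M + 1)"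
  have p: "int p = (int k - 1) div M + 1"
    using k M by (simp add: p_def pos_imp_zdiv_nonneg_iff)
  have dm: "M * ((int k - 1) div M) + (int k - 1) mod M = int k - 1" by simp
  have "M * (int p - 1) < int k"
    unfolding p add_diff_cancel_right' using dm pos_mod_sign[OF M, of "int k - 1"] by linarith
  then have inj: "inj_on (\<lambda>b. L' #> lincomb G E b) (E \<rightarrow>\<^sub>E {0..<int p})"
    using quasi_basis_small_mod_powers[OF qb L _ L'(2)]
    by (intro inj_on_rcoset_lincomb[OF E L'(1)]) blast
  have "p ^ card E = card ((\<lambda>b. L' #> lincomb G E b) ` (E \<rightarrow>\<^sub>E {0..<int p}))"
    using card_image[OF inj] E by (simp add: card_PiE)
  also have "\<dots> \<le> card ((\<lambda>x. L' #> x) ` carrier G)"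
    using E fin by (intro card_mono) auto
  finally have *: "p ^ card E \<le> card ((\<lambda>x. L' #> x) ` carrier G)" .
  have "int k \<le> M * int p"
    unfolding p ring_distribs using dm pos_mod_bound[OF M, of "int k - 1"] by linarith
  then have "int k \<le> int (nat M * p)" using M by simp
  then have "k \<le> nat M * p" by (simp only: of_nat_le_iff)
  then have "k ^ card E \<le> (nat M * p) ^ card E" by (rule power_mono) simp
  also have "\<dots> \<le> nat M ^ card E * card ((\<lambda>x. L' #> x) ` carrier G)"
    using * by (simp add: power_mult_distrib)
  finally show ?thesis .
qed

end

section \<open>Free rank\<close>

context comm_group
begin

lemma free_rank_eq_card_basis:
  assumes E: "finite E" "E \<subseteq> carrier G" and ind: "indep_mod G {\<one>} E"
    and span: "generate G E = carrier G"
  shows "free_rank G = card E"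
proof -
  define h where "h c = lincomb G E (Poly_Mapping.lookup c)" for c :: "'a \<Rightarrow>\<^sub>0 int"
  have "h \<in> iso (free_Abelian_group E) G"
  proof (rule isoI)
    show "h \<in> hom (free_Abelian_group E) G"
      using E by (auto intro!: homI simp: h_def plus_poly_mapping.rep_eq lincomb_add)
    show "bij_betw h (carrier (free_Abelian_group E)) (carrier G)"
    proof (rule bij_betwI')
      fix c d assume cd: "c \<in> carrier (free_Abelian_group E)" "d \<in> carrier (free_Abelian_group E)"
      show "h c = h d \<longleftrightarrow> c = d"
      proof
        assume "h c = h d"
        then have "lincomb G E (\<lambda>e. Poly_Mapping.lookup c e - Poly_Mapping.lookup d e) = \<one>"
          using E by (simp add: lincomb_diff h_def)
        then have "\<forall>e\<in>E. Poly_Mapping.lookup c e = Poly_Mapping.lookup d e"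
          using ind unfolding indep_mod_def by fastforce
        moreover have "Poly_Mapping.lookup c e = Poly_Mapping.lookup d e" if "e \<notin> E" for e
          using cd that by (metis carrier_free_Abelian_group_iff in_keys_iff subsetD)
        ultimately show "c = d" by (intro poly_mapping_eqI) blast
      qed simp
    next
      fix x assume "x \<in> carrier G"
      then obtain a where a: "x = lincomb G E a"
        using generate_eq_range_lincomb[OF E] span by auto
      define c where "c = Abs_poly_mapping (\<lambda>e. if e \<in> E then a e else 0)"
      have c: "Poly_Mapping.lookup c e = (if e \<in> E then a e else 0)" for e
        unfolding c_def by (subst lookup_Abs_poly_mapping)
          (use E in \<open>auto intro: finite_subset[of _ E]\<close>)
      have "x = h c" unfolding a h_def using E by (intro lincomb_cong) (auto simp: c)
      moreover have "c \<in> carrier (free_Abelian_group E)"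
        by (auto simp: in_keys_iff c split: if_splits)
      ultimately show "\<exists>c\<in>carrier (free_Abelian_group E). x = h c" by blast
    qed (use E in \<open>auto simp: h_def\<close>)
  qed
  then have EG: "free_Abelian_group E \<cong> G" unfolding is_iso_def by blast
  then have GE: "G \<cong> free_Abelian_group E"
    using group.iso_sym[OF group_free_Abelian_group] by blast
  have "G \<cong> free_Abelian_group {..<n} \<longleftrightarrow> n = card E" for n :: nat
  proof -
    have "G \<cong> free_Abelian_group {..<n} \<longleftrightarrow> free_Abelian_group E \<cong> free_Abelian_group {..<n}"
      using iso_trans[OF GE] iso_trans[OF EG] by (rule iffI[rotated])
    also have "\<dots> \<longleftrightarrow> E \<approx> {..<n}" by (rule isomorphic_free_Abelian_groups)
    also have "\<dots> \<longleftrightarrow> n = card E"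
      using eqpoll_iff_card[OF E(1), of "{..<n}"] by auto
    finally show ?thesis .
  qed
  then show ?thesis unfolding free_rank_def by simp
qed

lemma torsion_free_int_pow:
  assumes "torsion_free G" "x \<in> carrier G" "x [^] (k::int) = \<one>" "k \<noteq> 0"
  shows "x = \<one>"
proof -
  have "x [^] nat \<bar>k\<bar> = \<one>"
  proof -
    have "x [^] \<bar>k\<bar> = \<one>"
      unfolding abs_if by (simp add: assms(2,3) int_pow_neg)
    then show ?thesis by (metis abs_ge_zero int_nat_eq int_pow_int)
  qed
  moreover have "nat \<bar>k\<bar> > 0" using assms(4) by simp
  ultimately show ?thesis using assms(1,2) unfolding torsion_free_def by blast
qed

lemma generate_exchange:
  assumes gen: "generate G T = carrier G" and T': "T' \<subseteq> carrier G"
    and T: "T \<subseteq> generate G T'"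
  shows "generate G T' = carrier G"
  using generate_subgroup_incl[OF T generate_is_subgroup[OF T']] gen generate_incl[OF T']
  by auto

text \<open>
  A generating set of least size in a torsion-free group has no relations. Otherwise, subtract the
  smaller of two nonzero coefficients from the larger one, as in the Euclidean algorithm, by
  replacing the generator \<open>x\<close> with \<open>x y\<^sup>s\<close>, \<open>s = \<plusminus>1\<close>. This lowers the sum of absolute values, until a
  single coefficient remains and torsion-freeness makes that generator superfluous.
\<close>

lemma minimal_generators_relation_trivial:
  assumes tf: "torsion_free G"
    and min: "\<And>T'. finite T' \<Longrightarrow> T' \<subseteq> carrier G \<Longrightarrow> generate G T' = carrier G \<Longrightarrow> n \<le> card T'"
    and "finite T" "T \<subseteq> carrier G" "generate G T = carrier G" "card T = n" "lincomb G T a = \<one>"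
  shows "\<forall>t\<in>T. a t = 0"
  using assms(3-)
proof (induction "nat (\<Sum>t\<in>T. \<bar>a t\<bar>)" arbitrary: T a rule: less_induct)
  case less
  note T = less.prems(1,2) and gen = less.prems(3) and card = less.prems(4) and rel = less.prems(5)
  show ?case
  proof (rule ccontr)
    assume "\<not> (\<forall>t\<in>T. a t = 0)"
    then obtain t where t: "t \<in> T" "a t \<noteq> 0" by blast
    \<comment> \<open>If only one coefficient were nonzero, its generator would be trivial and could be dropped.\<close>
    have "\<exists>u\<in>T - {t}. a u \<noteq> 0"
    proof (rule ccontr)
      assume "\<not> ?thesis"
      then have zero: "lincomb G T a = lincomb G T (\<lambda>x. if x = t then a t else 0)"
        using T t by (intro lincomb_cong) auto
      then have "t [^] a t = \<one>" using rel lincomb_delta[OF T t(1)] by simp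
      then have "t = \<one>" using torsion_free_int_pow[OF tf _ _ t(2)] t T by blast
      then have "T \<subseteq> generate G (T - {t})"
        using generate.one[of G "T - {t}"] generate.incl[of _ "T - {t}" G] by auto
      then have "generate G (T - {t}) = carrier G"
        using T by (intro generate_exchange[OF gen]) auto
      then have "n \<le> card (T - {t})" using T by (intro min) auto
      then show False using card T t by (metis card_Diff1_less not_le)
    qed
    then obtain u where u: "u \<in> T" "u \<noteq> t" "a u \<noteq> 0" by blast
    obtain x y where xy: "x \<in> T" "y \<in> T" "x \<noteq> y" "a x \<noteq> 0" "\<bar>a x\<bar> \<le> \<bar>a y\<bar>"
      using t u by (metis linorder_linear)
    define s where "s = sgn (a x) * sgn (a y)"
    define w where "w = x \<otimes> y [^] s"
    define R where "R = T - {x, y}"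
    have R: "finite R" "R \<subseteq> carrier G" "x \<notin> R" "y \<notin> R" and TR: "T = insert x (insert y R)"
      using T xy by (auto simp: R_def)
    have xyc: "x \<in> carrier G" "y \<in> carrier G" and w: "w \<in> carrier G"
      using xy T by (auto simp: w_def)
    define T' where "T' = insert w (insert y R)"
    have T': "finite T'" "T' \<subseteq> carrier G" using R w xyc by (auto simp: T'_def)
    have "x = w \<otimes> inv (y [^] s)" using xyc by (simp add: w_def m_assoc)
    moreover have "y [^] s \<in> generate G T'"
      by (intro subgroup_int_pow_closed generate_is_subgroup T' generate.incl) (simp add: T'_def)
    moreover have "w \<in> generate G T'" by (intro generate.incl) (simp add: T'_def)
    ultimately have "x \<in> generate G T'"
      using generate.eng generate_m_inv_closed[OF T'(2)] by metis
    then have "T \<subseteq> generate G T'"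
      unfolding TR using generate.incl[of _ T' G] by (auto simp: T'_def)
    then have gen': "generate G T' = carrier G"
      using T T' by (intro generate_exchange[OF gen]) auto
    then have n: "n \<le> card T'" using T' by (intro min) auto
    have cardT: "n = Suc (Suc (card R))" using card R xy(3) by (simp add: TR)
    \<comment> \<open>Otherwise the new generating set would be smaller than the minimum \<open>n\<close>.\<close>
    have w_notin: "w \<notin> insert y R"
    proof
      assume "w \<in> insert y R"
      then have "card T' = card (insert y R)" by (simp add: T'_def insert_absorb)
      then show False using n cardT R by simp
    qed
    have card': "card T' = n" using cardT w_notin R by (simp add: T'_def)
    define a' where "a' = a(w := a x, y := a y - s * a x)"
    have a'w: "a' w = a x" and a'y: "a' y = a y - s * a x" using w_notin by (auto simp: a'_def)
    have a'R: "a' r = a r" if "r \<in> R" for r using that w_notin R by (auto simp: a'_def)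
    have "lincomb G T' a' = w [^] a x \<otimes> (y [^] (a y - s * a x) \<otimes> lincomb G R a')"
      unfolding T'_def using R w xyc w_notin by (simp add: lincomb_insert a'w a'y)
    also have "lincomb G R a' = lincomb G R a" using R by (intro lincomb_cong) (auto simp: a'R)
    also have "w [^] a x \<otimes> (y [^] (a y - s * a x) \<otimes> lincomb G R a)
        = x [^] a x \<otimes> (y [^] (s * a x) \<otimes> y [^] (a y - s * a x)) \<otimes> lincomb G R a"
      using xyc R by (simp add: w_def int_pow_distrib int_pow_pow m_assoc)
    also have "y [^] (s * a x) \<otimes> y [^] (a y - s * a x) = y [^] a y"
      using xyc by (simp flip: int_pow_mult)
    also have "x [^] a x \<otimes> y [^] a y \<otimes> lincomb G R a = lincomb G T a"
      unfolding TR using R xyc xy(3) by (simp add: lincomb_insert m_assoc)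
    finally have rel': "lincomb G T' a' = \<one>" using rel by simp
    have "\<bar>a y - s * a x\<bar> = \<bar>a y\<bar> - \<bar>a x\<bar>"
      using xy(4,5) unfolding s_def by (cases "a x > 0"; cases "a y > 0") (auto simp: sgn_if)
    moreover have "(\<Sum>r\<in>R. \<bar>a' r\<bar>) = (\<Sum>r\<in>R. \<bar>a r\<bar>)" using a'R by simp
    ultimately have "(\<Sum>t\<in>T'. \<bar>a' t\<bar>) < (\<Sum>t\<in>T. \<bar>a t\<bar>)"
      unfolding TR T'_def using R xy(3,4) w_notin by (simp add: a'w a'y)
    moreover have "(\<Sum>t\<in>T'. \<bar>a' t\<bar>) \<ge> 0" by (simp add: sum_nonneg)
    ultimately have "nat (\<Sum>t\<in>T'. \<bar>a' t\<bar>) < nat (\<Sum>t\<in>T. \<bar>a t\<bar>)"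
      by (simp only: nat_less_eq_zless)
    then have "\<forall>t\<in>T'. a' t = 0" using T' gen' card' rel' by (rule less.hyps)
    then show False using a'w xy(4) by (auto simp: T'_def)
  qed
qed

lemma torsion_free_basis_ex:
  assumes tf: "torsion_free G" and "finite T" "T \<subseteq> carrier G" "generate G T = carrier G"
  shows "\<exists>E. finite E \<and> E \<subseteq> carrier G \<and> indep_mod G {\<one>} E \<and> generate G E = carrier G"
proof -
  define P where "P E \<longleftrightarrow> finite E \<and> E \<subseteq> carrier G \<and> generate G E = carrier G" for E
  have "P T" using assms by (simp add: P_def)
  then obtain E where E: "P E" and min: "\<And>F. P F \<Longrightarrow> card E \<le> card F"
    using ex_has_least_nat[of P T card] by auto
  have "indep_mod G {\<one>} E"
    unfolding indep_mod_def
    using minimal_generators_relation_trivial[OF tf, of "card E" E] E min by (auto simp: P_def)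
  then show ?thesis using E by (auto simp: P_def)
qed

lemma subgroup_powers: "subgroup ((\<lambda>x. x [^] (k::int)) ` carrier G) G"
proof
  show "\<one> \<in> (\<lambda>x. x [^] k) ` carrier G" by (metis imageI int_pow_one one_closed)
  show "x \<otimes> y \<in> (\<lambda>x. x [^] k) ` carrier G"
    if "x \<in> (\<lambda>x. x [^] k) ` carrier G" "y \<in> (\<lambda>x. x [^] k) ` carrier G" for x y
    using that by (auto simp flip: int_pow_distrib)
  show "inv x \<in> (\<lambda>x. x [^] k) ` carrier G" if "x \<in> (\<lambda>x. x [^] k) ` carrier G" for x
    using that by (auto simp flip: int_pow_inv)
qed auto

text \<open>
  The number of cosets of \<open>G\<^sup>k L\<close> is at least a constant times \<open>k ^ card E\<close> and at most a constant
  times \<open>k ^ card E'\<close>, for every \<open>k\<close>.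
\<close>

lemma quasi_basis_card_le:
  assumes T: "finite T" "T \<subseteq> carrier G" "generate G T = carrier G" and L: "subgroup L G"
    and E: "quasi_basis G L E M" and E': "quasi_basis G L E' M'"
  shows "card E \<le> card E'"
proof (rule ccontr)
  assume less: "\<not> card E \<le> card E'"
  interpret L: subgroup L G by fact
  obtain C :: nat where C: "\<forall>k\<ge>1. \<forall>L'. subgroup L' G \<longrightarrow> L \<subseteq> L' \<longrightarrow>
           (\<forall>x\<in>carrier G. x [^] int k \<in> L') \<longrightarrow>
           finite ((\<lambda>x. L' #> x) ` carrier G) \<and>
           card ((\<lambda>x. L' #> x) ` carrier G) \<le> C * k ^ card E'"
    using card_rcosets_mod_powers_le[OF E' T L] ..
  \<comment> \<open>One more than the product of the two constants, so that a single extra factor \<open>k\<close> beats them.\<close>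
  define k where "k = nat M ^ card E * C + 1"
  define L' where "L' = (\<lambda>x. x [^] int k) ` carrier G <#> L"
  have L': "subgroup L' G" unfolding L'_def by (intro mult_subgroups subgroup_powers L)
  have "L \<subseteq> L'"
  proof
    fix l assume l: "l \<in> L"
    then have "l = \<one> [^] int k \<otimes> l" by simp
    then show "l \<in> L'" unfolding L'_def set_mult_def using l one_closed by blast
  qed
  moreover have "x [^] int k \<in> L'" if x: "x \<in> carrier G" for x
  proof -
    have "x [^] int k = x [^] int k \<otimes> \<one>" using x by simp
    then show ?thesis unfolding L'_def set_mult_def using x L.one_closed by blast
  qed
  moreover have k: "k \<ge> 1" by (simp add: k_def)
  ultimately have fin: "finite ((\<lambda>x. L' #> x) ` carrier G)"
      and up: "card ((\<lambda>x. L' #> x) ` carrier G) \<le> C * k ^ card E'"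
    using C L' by auto
  have decomp: "\<exists>y\<in>carrier G. \<exists>l\<in>L. x = y [^] int k \<otimes> l" if "x \<in> L'" for x
    using that by (auto simp: L'_def set_mult_def)
  have "k ^ card E \<le> nat M ^ card E * card ((\<lambda>x. L' #> x) ` carrier G)"
    by (rule power_le_card_rcosets_mod_powers[OF E L k L' decomp fin])
  also have "\<dots> \<le> nat M ^ card E * (C * k ^ card E')"
    using up by (rule mult_left_mono) simp
  also have "\<dots> < k * k ^ card E'" using k by (simp add: k_def)
  also have "\<dots> = k ^ Suc (card E')" by simp
  also have "\<dots> \<le> k ^ card E" using less k by (intro power_increasing) auto
  finally show False by simp
qed

lemma mult_inv_mult:
  assumes "x \<in> carrier G" "y \<in> carrier G" "s \<in> carrier G" "t \<in> carrier G"
  shows "(x \<otimes> y) \<otimes> inv (s \<otimes> t) = (x \<otimes> inv s) \<otimes> (y \<otimes> inv t)"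
  using assms by (simp add: inv_mult m_ac)

lemma subgroup_is_comm_group:
  assumes "subgroup L G"
  shows "comm_group (G\<lparr>carrier := L\<rparr>)"
  using subgroup.subset[OF assms]
  by (intro group.group_comm_groupI subgroup_imp_group[OF assms]) (simp_all add: m_comm subsetD)

lemma lincomb_consistent:
  assumes L: "subgroup L G" and "finite F" "F \<subseteq> L"
  shows "lincomb (G\<lparr>carrier := L\<rparr>) F a = lincomb G F a"
  using assms(2,3)
proof (induction F)
  interpret L: comm_group "G\<lparr>carrier := L\<rparr>" by (rule subgroup_is_comm_group[OF L])
  case empty
  then show ?case using L.lincomb_empty[of a] by simp
next
  interpret L: comm_group "G\<lparr>carrier := L\<rparr>" by (rule subgroup_is_comm_group[OF L])
  case (insert t F)
  have "insert t F \<subseteq> carrier G" using insert.prems subgroup.subset[OF L] by blast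
  then show ?case
    using insert int_pow_consistent[OF L, of t "a t"]
    by (simp add: lincomb_insert L.lincomb_insert)
qed

text \<open>
  A basis of \<open>L\<close> together with \<open>E\<close> is a quasi-basis modulo the trivial subgroup, and so is a basis of
  the whole group; by the preceding bounds they have equally many elements.
\<close>

lemma quasi_basis_rank:
  assumes tf: "torsion_free G" and T: "finite T" "T \<subseteq> carrier G" "generate G T = carrier G"
    and U: "finite U" "U \<subseteq> carrier G" "generate G U = L"
    and qb: "quasi_basis G L E M"
  shows "free_rank G = free_rank (G\<lparr>carrier := L\<rparr>) + card E"
proof -
  have L: "subgroup L G" using U generate_is_subgroup by blast
  interpret L: subgroup L G by fact
  interpret GL: comm_group "G\<lparr>carrier := L\<rparr>" by (rule subgroup_is_comm_group[OF L])
  have UL: "U \<subseteq> L" using U generate.incl[of _ U G] by blast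
  have E: "finite E" "E \<subseteq> carrier G" and indE: "indep_mod G L E" and M: "M > 0"
    using qb by (auto simp: quasi_basis_def)
  have "torsion_free (G\<lparr>carrier := L\<rparr>)"
    using tf by (auto simp: torsion_free_def simp flip: nat_pow_consistent)
  then obtain F where F: "finite F" "F \<subseteq> L" and indF: "indep_mod (G\<lparr>carrier := L\<rparr>) {\<one>} F"
      and "generate (G\<lparr>carrier := L\<rparr>) F = L"
    using GL.torsion_free_basis_ex[of U] U UL generate_consistent[OF UL L] by auto
  then have "free_rank (G\<lparr>carrier := L\<rparr>) = card F" and genF: "generate G F = L"
    using GL.free_rank_eq_card_basis[of F] generate_consistent[OF F(2) L] by auto
  moreover obtain B where B: "finite B" "B \<subseteq> carrier G" "indep_mod G {\<one>} B"
      "generate G B = carrier G"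
    using torsion_free_basis_ex[OF tf T] by blast
  then have "free_rank G = card B" using free_rank_eq_card_basis by blast
  moreover have "card B = card F + card E"
  proof -
    have Fc: "F \<subseteq> carrier G" using F L.subset by blast
    have spanF: "L = range (lincomb G F)" using genF generate_eq_range_lincomb[OF F(1) Fc] by simp
    have "\<exists>b. \<exists>l\<in>{\<one>}. x [^] (1::int) = lincomb G B b \<otimes> l" if "x \<in> carrier G" for x
    proof -
      have "x \<in> range (lincomb G B)"
        using that generate_eq_range_lincomb[OF B(1,2)] B(4) by simp
      then obtain b where "x = lincomb G B b" ..
      then show ?thesis using B that by auto
    qed
    then have qB: "quasi_basis G {\<one>} B 1"
      unfolding quasi_basis_def using B(1-3) by simp
    have disj: "F \<inter> E = {}"
    proof (rule ccontr)
      assume "F \<inter> E \<noteq> {}"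
      then obtain e where e: "e \<in> F" "e \<in> E" by blast
      then have "lincomb G E (\<lambda>x. if x = e then 1 else 0) \<in> L"
        using lincomb_delta[OF E, of e 1] F E by auto
      then show False
        using indE[unfolded indep_mod_def, rule_format, of "\<lambda>x. if x = e then 1 else 0" e] e(2)
        by simp
    qed
    have split: "lincomb G (F \<union> E) a = lincomb G F a \<otimes> lincomb G E a" for a
      using F E Fc disj by (intro lincomb_Un_disjoint)
    have "indep_mod G {\<one>} (F \<union> E)"
      unfolding indep_mod_def
    proof (intro allI impI)
      fix a assume "lincomb G (F \<union> E) a \<in> {\<one>}"
      then have one: "lincomb G F a \<otimes> lincomb G E a = \<one>" using split by simp
      then have "lincomb G E a = inv (lincomb G F a)"
        using Fc E by (metis inv_equality inv_inv lincomb_closed)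
      also have "\<dots> \<in> L" by (intro L.m_inv_closed lincomb_in_subgroup[OF L F])
      finally have aE: "\<forall>e\<in>E. a e = 0" using indE unfolding indep_mod_def by blast
      then have "lincomb G E a = lincomb G E (\<lambda>_. 0)" using E by (intro lincomb_cong) auto
      then have "lincomb G F a = \<one>" using one Fc by simp
      then have "\<forall>e\<in>F. a e = 0"
        using indF lincomb_consistent[OF L F] unfolding indep_mod_def by simp
      with aE show "\<forall>e\<in>F \<union> E. a e = 0" by blast
    qed
    moreover have "\<exists>b. \<exists>l\<in>{\<one>}. x [^] M = lincomb G (F \<union> E) b \<otimes> l" if x: "x \<in> carrier G" for x
    proof -
      obtain b l where b: "l \<in> L" "x [^] M = lincomb G E b \<otimes> l"
        using qb x unfolding quasi_basis_def by blast
      then obtain c where c: "l = lincomb G F c" using spanF by blast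
      define d where "d e = (if e \<in> F then c e else b e)" for e
      have "lincomb G F d = lincomb G F c" "lincomb G E d = lincomb G E b"
        using Fc E disj by (auto simp: d_def intro!: lincomb_cong)
      then have "x [^] M = lincomb G (F \<union> E) d \<otimes> \<one>"
        using b c Fc E by (simp add: split m_comm)
      then show ?thesis by blast
    qed
    ultimately have "quasi_basis G {\<one>} (F \<union> E) M"
      unfolding quasi_basis_def using F Fc E M by blast
    then have "card B = card (F \<union> E)"
      using quasi_basis_card_le[OF T triv_subgroup] qB by (intro le_antisym)
    then show ?thesis using card_Un_disjoint[OF F(1) E(1) disj] by simp
  qed
  ultimately show ?thesis by simp
qed

end

section \<open>Twisted conjugacy in quotients\<close>

lemma card_image_le_of_factor:
  assumes "\<And>x y. x \<in> A \<Longrightarrow> y \<in> A \<Longrightarrow> p x = p y \<Longrightarrow> q x = q y" and "finite (p ` A)"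
  shows "finite (q ` A) \<and> card (q ` A) \<le> card (p ` A)"
proof -
  have "q ` A = (\<lambda>c. q (inv_into A p c)) ` (p ` A)"
  proof -
    have "q (inv_into A p (p x)) = q x" if "x \<in> A" for x
      using that by (intro assms(1)) (auto intro: inv_into_into f_inv_into_f)
    then show ?thesis by (force simp: image_iff)
  qed
  then show ?thesis using assms(2) by (metis card_image_le finite_imageI)
qed

lemma card_image_le_fibres:
  assumes "\<And>x. x \<in> A \<Longrightarrow> card (p ` {y \<in> A. q y = q x}) \<le> m" and "finite (q ` A)"
  shows "card (p ` A) \<le> m * card (q ` A)"
proof -
  have "p ` A = (\<Union>c\<in>q ` A. p ` {y \<in> A. q y = c})" by auto
  then have "card (p ` A) \<le> (\<Sum>c\<in>q ` A. card (p ` {y \<in> A. q y = c}))"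
    using card_UN_le[OF assms(2)] by metis
  also have "\<dots> \<le> (\<Sum>c\<in>q ` A. m)" using assms(1) by (intro sum_mono) auto
  finally show ?thesis by (simp add: mult.commute)
qed

context group
begin

lemma rcos_eq_iff:
  assumes "subgroup L G" "x \<in> carrier G" "y \<in> carrier G"
  shows "L #> x = L #> y \<longleftrightarrow> (\<exists>l\<in>L. x = l \<otimes> y)"
proof
  assume "L #> x = L #> y"
  then have "x \<in> L #> y" using rcos_self[OF assms(2,1)] by simp
  then show "\<exists>l\<in>L. x = l \<otimes> y" by (auto simp: r_coset_def)
next
  assume "\<exists>l\<in>L. x = l \<otimes> y"
  then have "x \<in> L #> y" by (auto simp: r_coset_def)
  then show "L #> x = L #> y" using repr_independence assms by metis
qed

lemma equiv_twisted_conj: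
  assumes "\<psi> \<in> hom G G"
  shows "equiv (carrier G) (twisted_conj G \<psi>)"
proof (rule equivI)
  interpret psi: group_hom G G \<psi> by unfold_locales fact
  show "twisted_conj G \<psi> \<subseteq> carrier G \<times> carrier G" by (auto simp: twisted_conj_def)
  show "refl_on (carrier G) (twisted_conj G \<psi>)"
  proof (rule refl_onI)
    fix g assume "g \<in> carrier G"
    then show "(g, g) \<in> twisted_conj G \<psi>"
      unfolding twisted_conj_def by (auto intro!: bexI[of _ \<one>])
  qed
  show "sym (twisted_conj G \<psi>)"
  proof (rule symI)
    fix g h assume "(g, h) \<in> twisted_conj G \<psi>"
    then obtain z where z: "z \<in> carrier G" "g \<in> carrier G" "h \<in> carrier G"
        "g = z \<otimes> h \<otimes> inv (\<psi> z)"
      unfolding twisted_conj_def by blast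
    then have "h = inv z \<otimes> g \<otimes> inv (\<psi> (inv z))"
      by (simp add: m_assoc inv_solve_left)
    then show "(h, g) \<in> twisted_conj G \<psi>" using z unfolding twisted_conj_def by blast
  qed
  show "trans (twisted_conj G \<psi>)"
  proof (rule transI)
    fix a b c assume "(a, b) \<in> twisted_conj G \<psi>" "(b, c) \<in> twisted_conj G \<psi>"
    then obtain z w where z: "z \<in> carrier G" "a \<in> carrier G" "b \<in> carrier G" "c \<in> carrier G"
        "w \<in> carrier G" "a = z \<otimes> b \<otimes> inv (\<psi> z)" "b = w \<otimes> c \<otimes> inv (\<psi> w)"
      unfolding twisted_conj_def by blast
    then have "a = (z \<otimes> w) \<otimes> c \<otimes> inv (\<psi> (z \<otimes> w))"
      by (simp add: m_assoc inv_mult_group)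
    then show "(a, c) \<in> twisted_conj G \<psi>" using z unfolding twisted_conj_def by blast
  qed
qed

lemma twisted_class_eq_iff:
  assumes "\<psi> \<in> hom G G" "g \<in> carrier G" "h \<in> carrier G"
  shows "twisted_class G \<psi> g = twisted_class G \<psi> h \<longleftrightarrow>
    (\<exists>z\<in>carrier G. g = z \<otimes> h \<otimes> inv (\<psi> z))"
  using eq_equiv_class_iff[OF equiv_twisted_conj[OF assms(1)] assms(2,3)] assms(2,3)
  by (simp add: twisted_class_def twisted_conj_def)

end

locale invariant_normal = normal K G for K and G (structure) +
  fixes \<phi> :: "'a \<Rightarrow> 'a"
  assumes endo: "\<phi> \<in> hom G G" and invariant: "\<phi> ` K \<subseteq> K"
begin

sublocale phi: group_hom G G \<phi> by unfold_locales (rule endo)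

lemma induced_map_rcos:
  assumes g: "g \<in> carrier G"
  shows "induced_map G K \<phi> (K #> g) = K #> \<phi> g"
proof -
  have const: "K #> \<phi> x = K #> \<phi> g" if "x \<in> K #> g" for x
  proof -
    obtain k where k: "k \<in> K" "x = k \<otimes> g" using \<open>x \<in> K #> g\<close> by (auto simp: r_coset_def)
    then have "\<phi> x = \<phi> k \<otimes> \<phi> g" "\<phi> k \<in> K" using g invariant by auto
    then show ?thesis using g k by (subst rcos_eq_iff[OF is_subgroup]) auto
  qed
  have "(\<lambda>x. K #> \<phi> x) ` (K #> g) = (\<lambda>_. K #> \<phi> g) ` (K #> g)"
    by (rule image_cong[OF refl const])
  also have "\<dots> = {K #> \<phi> g}" using rcos_self[OF g is_subgroup] by blast
  finally have "(\<lambda>x. K #> \<phi> x) ` (K #> g) = {K #> \<phi> g}" .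
  then show ?thesis unfolding induced_map_def by simp
qed

lemma induced_map_hom: "induced_map G K \<phi> \<in> hom (G Mod K) (G Mod K)"
proof (rule homI)
  fix A B assume "A \<in> carrier (G Mod K)" "B \<in> carrier (G Mod K)"
  then obtain a b where ab: "a \<in> carrier G" "A = K #> a" "b \<in> carrier G" "B = K #> b"
    unfolding carrier_FactGroup by blast
  then have "A <#> B = K #> (a \<otimes> b)" by (simp add: rcos_sum)
  then show "induced_map G K \<phi> (A \<otimes>\<^bsub>G Mod K\<^esub> B)
      = induced_map G K \<phi> A \<otimes>\<^bsub>G Mod K\<^esub> induced_map G K \<phi> B"
    using ab by (simp add: induced_map_rcos rcos_sum)
next
  fix A assume "A \<in> carrier (G Mod K)"
  then obtain a where a: "a \<in> carrier G" "A = K #> a"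
    unfolding carrier_FactGroup by blast
  then show "induced_map G K \<phi> A \<in> carrier (G Mod K)"
    unfolding carrier_FactGroup using induced_map_rcos phi.hom_closed by blast
qed

text \<open>
  Twisted conjugacy in the quotient by \<open>K\<close>, pulled back to \<open>G\<close>. Since the case of trivial \<open>K\<close> is
  twisted conjugacy in \<open>G\<close> itself, this form allows both growth functions to be treated alike.
\<close>

lemma quotient_class_eq_iff:
  assumes g: "g \<in> carrier G" and h: "h \<in> carrier G"
  shows "twisted_class (G Mod K) (induced_map G K \<phi>) (K #> g)
       = twisted_class (G Mod K) (induced_map G K \<phi>) (K #> h)
    \<longleftrightarrow> (\<exists>z\<in>carrier G. \<exists>k\<in>K. g = k \<otimes> (z \<otimes> h \<otimes> inv (\<phi> z)))"
proof -
  interpret Q: group "G Mod K" by (rule factorgroup_is_group)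
  have eq: "(K #> z) \<otimes>\<^bsub>G Mod K\<^esub> (K #> h) \<otimes>\<^bsub>G Mod K\<^esub> inv\<^bsub>G Mod K\<^esub> (induced_map G K \<phi> (K #> z))
      = K #> (z \<otimes> h \<otimes> inv (\<phi> z))" if "z \<in> carrier G" for z
  proof -
    have "inv\<^bsub>G Mod K\<^esub> (K #> \<phi> z) = K #> inv (\<phi> z)"
      using that by (simp add: inv_FactGroup carrier_FactGroup rcos_inv)
    then show ?thesis using that h by (simp add: induced_map_rcos rcos_sum)
  qed
  have "twisted_class (G Mod K) (induced_map G K \<phi>) (K #> g)
       = twisted_class (G Mod K) (induced_map G K \<phi>) (K #> h)
    \<longleftrightarrow> (\<exists>z\<in>carrier G. K #> g = K #> (z \<otimes> h \<otimes> inv (\<phi> z)))"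
  proof -
    have "K #> g \<in> carrier (G Mod K)" "K #> h \<in> carrier (G Mod K)"
      using g h unfolding carrier_FactGroup by blast+
    then show ?thesis
      unfolding Q.twisted_class_eq_iff[OF induced_map_hom \<open>K #> g \<in> _\<close> \<open>K #> h \<in> _\<close>]
      unfolding carrier_FactGroup bex_simps using eq by (simp cong: bex_cong del: mult_FactGroup)
  qed
  also have "\<dots> \<longleftrightarrow> (\<exists>z\<in>carrier G. \<exists>k\<in>K. g = k \<otimes> (z \<otimes> h \<otimes> inv (\<phi> z)))"
    using g h by (intro bex_cong refl rcos_eq_iff[OF is_subgroup]) auto
  finally show ?thesis .
qed

lemma reidemeister_number_quotient:
  "reidemeister_number (G Mod K) (induced_map G K \<phi>)
   = card ((\<lambda>g. twisted_class (G Mod K) (induced_map G K \<phi>) (K #> g)) ` carrier G)"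
  unfolding reidemeister_number_def quotient_def twisted_class_def carrier_FactGroup
  by (intro arg_cong[where f = card]) blast

end

section \<open>Twisted classes inside a coset of an abelian normal subgroup\<close>

locale virtually_abelian_endo = normal N G for N and G (structure) +
  fixes \<phi> :: "'a \<Rightarrow> 'a"
  assumes endo: "\<phi> \<in> hom G G" and invariant: "\<phi> ` N \<subseteq> N"
    and comm_N: "comm_group (G\<lparr>carrier := N\<rparr>)" and fin_index: "finite (rcosets N)"
begin

abbreviation NG where "NG \<equiv> G\<lparr>carrier := N\<rparr>"

sublocale phi: group_hom G G \<phi> by unfold_locales (rule endo)
sublocale NG: comm_group NG by (rule comm_N)

lemma N_comm: "x \<in> N \<Longrightarrow> y \<in> N \<Longrightarrow> x \<otimes> y = y \<otimes> x"
  using NG.m_comm[of x y] by simp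

lemma N_inv [simp]: "x \<in> N \<Longrightarrow> inv\<^bsub>NG\<^esub> x = inv x"
  using m_inv_consistent[OF is_subgroup] by simp

lemma phi_N: "x \<in> N \<Longrightarrow> \<phi> x \<in> N"
  using invariant by blast

abbreviation D where "D \<equiv> id_minus_twist G \<phi>"

lemma D_eq: "D g x = x \<otimes> inv (g \<otimes> \<phi> x \<otimes> inv g)"
  by (simp add: id_minus_twist_def conj_map_def)

lemma conj_N: "g \<in> carrier G \<Longrightarrow> x \<in> N \<Longrightarrow> g \<otimes> \<phi> x \<otimes> inv g \<in> N"
  using inv_op_closed2 phi_N by blast

lemma D_in_N: "g \<in> carrier G \<Longrightarrow> x \<in> N \<Longrightarrow> D g x \<in> N"
  unfolding D_eq using conj_N by blast

lemma D_hom: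
  assumes g: "g \<in> carrier G"
  shows "D g \<in> hom NG NG"
proof (rule homI)
  fix x y assume "x \<in> carrier NG" "y \<in> carrier NG"
  then have x: "x \<in> N" and y: "y \<in> N" by auto
  let ?t = "\<lambda>x. g \<otimes> \<phi> x \<otimes> inv g"
  have t: "?t x \<in> N" "?t y \<in> N" using conj_N g x y by auto
  have "?t (x \<otimes> y) = ?t x \<otimes> ?t y"
    using g x y by (simp add: m_assoc inv_solve_left)
  then have "D g (x \<otimes> y) = (x \<otimes> y) \<otimes> inv (?t x \<otimes> ?t y)" by (simp add: D_eq)
  also have "\<dots> = (x \<otimes> inv (?t x)) \<otimes> (y \<otimes> inv (?t y))"
    using NG.mult_inv_mult[of x y "?t x" "?t y"] t x y by simp
  finally show "D g (x \<otimes>\<^bsub>NG\<^esub> y) = D g x \<otimes>\<^bsub>NG\<^esub> D g y"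
    by (simp add: D_eq)
qed (use D_in_N g in auto)

text \<open>
  The identity behind the whole computation: in the coset \<open>N g\<close>, twisting by \<open>z \<in> N\<close> is translation
  by \<open>D g z\<close>, because \<open>g \<phi>(z)\<inverse> = (g \<phi>(z)\<inverse> g\<inverse>) g\<close> and \<open>N\<close> is abelian.
\<close>

lemma twist_by_N:
  assumes "g \<in> carrier G" "x \<in> N" "z \<in> N"
  shows "z \<otimes> (x \<otimes> g) \<otimes> inv (\<phi> z) = D g z \<otimes> x \<otimes> g"
proof -
  let ?t = "g \<otimes> \<phi> z \<otimes> inv g"
  have t: "?t \<in> N" using conj_N assms by auto
  have it: "inv ?t = g \<otimes> inv (\<phi> z) \<otimes> inv g"
    using assms by (simp add: inv_mult_group m_assoc)
  have "D g z \<otimes> x \<otimes> g = z \<otimes> (inv ?t \<otimes> x) \<otimes> g"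
    using assms t by (simp add: D_eq m_assoc)
  also have "inv ?t \<otimes> x = x \<otimes> inv ?t" using t assms by (intro N_comm) auto
  also have "z \<otimes> (x \<otimes> inv ?t) \<otimes> g = z \<otimes> (x \<otimes> g) \<otimes> inv (\<phi> z)"
    unfolding it using assms by (simp add: m_assoc)
  finally show ?thesis by simp
qed

lemma D_coset_invariant:
  assumes "g \<in> carrier G" "x \<in> N" "y \<in> N"
  shows "D (x \<otimes> g) y = D g y"
proof -
  let ?t = "g \<otimes> \<phi> y \<otimes> inv g"
  have t: "?t \<in> N" using conj_N assms by auto
  have "x \<otimes> g \<otimes> \<phi> y \<otimes> inv (x \<otimes> g) = x \<otimes> ?t \<otimes> inv x"
    using assms by (simp add: m_assoc inv_mult_group)
  also have "\<dots> = ?t" using N_comm[OF assms(2) t] assms t by (simp add: m_assoc)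
  finally show ?thesis by (simp add: D_eq)
qed

definition twist_image where "twist_image g = D g ` N"

lemma twist_image_subgroup:
  assumes "g \<in> carrier G" shows "subgroup (twist_image g) NG"
proof -
  interpret h: group_hom NG NG "D g" by unfold_locales (rule D_hom[OF assms])
  show ?thesis using h.img_is_subgroup by (simp add: twist_image_def)
qed

text \<open>
  The map \<open>F\<close> stands for any invariant that separates exactly the classes of twisted conjugacy modulo
  \<open>K\<close>. Elements of \<open>A g\<close> that agree modulo \<open>L\<close> are conjugate through \<open>N\<close>, up to \<open>K\<close>, which gives the first
  two claims. For the last one, fix \<open>x g\<close> and write the conjugating element as \<open>u t\<close> with \<open>u \<in> N\<close> and \<open>t\<close>
  a representative of its coset: conjugation by \<open>t\<close> gives one element of \<open>N g\<close>, and conjugation by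
  \<open>u\<close> does not leave its class modulo \<open>L\<close>. So a class meets at most as many \<open>L\<close>-cosets as there are
  cosets of \<open>N\<close>.
\<close>

lemma twisted_classes_coset_bounds:
  assumes g: "g \<in> carrier G" and K: "subgroup K NG"
    and F: "\<And>a b. a \<in> carrier G \<Longrightarrow> b \<in> carrier G \<Longrightarrow>
      F a = F b \<longleftrightarrow> (\<exists>z\<in>carrier G. \<exists>k\<in>K. a = k \<otimes> (z \<otimes> b \<otimes> inv (\<phi> z)))"
    and A: "A \<subseteq> N"
  defines "L \<equiv> twist_image g <#>\<^bsub>NG\<^esub> K"
  assumes fin: "finite ((\<lambda>x. L #>\<^bsub>NG\<^esub> x) ` A)"
  shows "finite ((\<lambda>x. F (x \<otimes> g)) ` A)"
    and "card ((\<lambda>x. F (x \<otimes> g)) ` A) \<le> card ((\<lambda>x. L #>\<^bsub>NG\<^esub> x) ` A)"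
    and "card ((\<lambda>x. L #>\<^bsub>NG\<^esub> x) ` A) \<le> card (rcosets N) * card ((\<lambda>x. F (x \<otimes> g)) ` A)"
proof -
  have KN: "K \<subseteq> N" using subgroup.subset[OF K] by simp
  have L: "subgroup L NG"
    unfolding L_def by (intro NG.mult_subgroups twist_image_subgroup g K)
  have Lmem: "l \<in> L \<longleftrightarrow> (\<exists>z\<in>N. \<exists>k\<in>K. l = D g z \<otimes> k)" for l
    by (auto simp: L_def set_mult_def twist_image_def)
  have Leq: "L #>\<^bsub>NG\<^esub> x = L #>\<^bsub>NG\<^esub> y \<longleftrightarrow> (\<exists>z\<in>N. \<exists>k\<in>K. x = D g z \<otimes> k \<otimes> y)"
    if "x \<in> N" "y \<in> N" for x y
  proof -
    have "L #>\<^bsub>NG\<^esub> x = L #>\<^bsub>NG\<^esub> y \<longleftrightarrow> (\<exists>l\<in>L. x = l \<otimes> y)"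
      using NG.rcos_eq_iff[OF L, of x y] that by simp
    also have "\<dots> \<longleftrightarrow> (\<exists>z\<in>N. \<exists>k\<in>K. x = D g z \<otimes> k \<otimes> y)"
      unfolding Lmem Bex_def by auto
    finally show ?thesis .
  qed
  have "F (x \<otimes> g) = F (y \<otimes> g)"
    if xy: "x \<in> A" "y \<in> A" and eq: "L #>\<^bsub>NG\<^esub> x = L #>\<^bsub>NG\<^esub> y" for x y
  proof -
    have x: "x \<in> N" and y: "y \<in> N" using xy A by auto
    obtain z k where z: "z \<in> N" "k \<in> K" "x = D g z \<otimes> k \<otimes> y" using eq Leq[OF x y] by blast
    have kN: "k \<in> N" and DN: "D g z \<in> N" using z KN D_in_N g by auto
    have "x \<otimes> g = k \<otimes> (D g z \<otimes> y \<otimes> g)"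
      unfolding z(3) using N_comm[OF DN kN] kN DN y g by (simp add: m_assoc)
    also have "D g z \<otimes> y \<otimes> g = z \<otimes> (y \<otimes> g) \<otimes> inv (\<phi> z)"
      using twist_by_N g y z by simp
    finally show ?thesis using F[of "x \<otimes> g" "y \<otimes> g"] z x y g by (meson m_closed mem_carrier)
  qed
  then have *: "finite ((\<lambda>x. F (x \<otimes> g)) ` A) \<and>
      card ((\<lambda>x. F (x \<otimes> g)) ` A) \<le> card ((\<lambda>x. L #>\<^bsub>NG\<^esub> x) ` A)"
    by (rule card_image_le_of_factor[OF _ fin])
  then show finF: "finite ((\<lambda>x. F (x \<otimes> g)) ` A)"
    and "card ((\<lambda>x. F (x \<otimes> g)) ` A) \<le> card ((\<lambda>x. L #>\<^bsub>NG\<^esub> x) ` A)" by auto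
  define rep where "rep C = (SOME t. t \<in> C)" for C :: "'a set"
  show "card ((\<lambda>x. L #>\<^bsub>NG\<^esub> x) ` A) \<le> card (rcosets N) * card ((\<lambda>x. F (x \<otimes> g)) ` A)"
  proof (rule card_image_le_fibres[OF _ finF])
    fix x assume "x \<in> A"
    then have x: "x \<in> N" using A by blast
    \<comment> \<open>The \<open>N\<close>-part of the conjugate of \<open>x g\<close> by the representative of \<open>C\<close>; it lies in \<open>N\<close> only for
      those \<open>C\<close> that contain an element conjugating \<open>x g\<close> back into \<open>N g\<close>.\<close>
    define w where "w C = rep C \<otimes> (x \<otimes> g) \<otimes> inv (\<phi> (rep C)) \<otimes> inv g" for C
    have "(\<lambda>x. L #>\<^bsub>NG\<^esub> x) ` {y \<in> A. F (y \<otimes> g) = F (x \<otimes> g)}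
        \<subseteq> (\<lambda>C. L #>\<^bsub>NG\<^esub> w C) ` (rcosets N)"
    proof safe
      fix y assume "y \<in> A" and eq: "F (y \<otimes> g) = F (x \<otimes> g)"
      then have y: "y \<in> N" using A by blast
      obtain z k where z: "z \<in> carrier G" "k \<in> K"
          "y \<otimes> g = k \<otimes> (z \<otimes> (x \<otimes> g) \<otimes> inv (\<phi> z))"
        using eq F[of "y \<otimes> g" "x \<otimes> g"] x y g by auto
      define C where "C = N #> z"
      have C: "C \<in> rcosets N" using z by (auto simp: C_def rcosetsI subset)
      define t where "t = rep C"
      have tC: "t \<in> N #> z"
        using rcos_self[OF z(1) is_subgroup] unfolding t_def rep_def C_def by (rule someI)
      then have t: "t \<in> carrier G" using z(1) subset by (auto simp: r_coset_def)
      then have "N #> z = N #> t"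
        using repr_independence[OF tC z(1) is_subgroup] by simp
      then obtain u where u: "u \<in> N" "z = u \<otimes> t"
        using rcos_eq_iff[OF is_subgroup z(1) t] by blast
      have kN: "k \<in> N" using z KN by auto
      define v where "v = w C"
      have v: "v \<in> carrier G" using t x g by (simp add: v_def w_def flip: t_def)
      have vg: "v \<otimes> g = t \<otimes> (x \<otimes> g) \<otimes> inv (\<phi> t)"
        using t x g by (simp add: v_def w_def m_assoc flip: t_def)
      have "y \<otimes> g = k \<otimes> (u \<otimes> (v \<otimes> g) \<otimes> inv (\<phi> u))"
        using z(3) kN u t x g by (simp add: vg m_assoc inv_mult_group)
      then have yg: "y \<otimes> g = k \<otimes> u \<otimes> v \<otimes> (g \<otimes> inv (\<phi> u))"
        using kN u v g by (simp add: m_assoc)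
      have "y = k \<otimes> u \<otimes> v \<otimes> (g \<otimes> inv (\<phi> u)) \<otimes> inv g"
        using yg y g kN u v by (metis inv_solve_right m_closed mem_carrier phi.hom_closed inv_closed)
      then have "y = (k \<otimes> u) \<otimes> v \<otimes> inv (g \<otimes> \<phi> u \<otimes> inv g)"
        using kN u v g by (simp add: m_assoc inv_mult_group)
      then have "v = inv (k \<otimes> u) \<otimes> (y \<otimes> (g \<otimes> \<phi> u \<otimes> inv g))"
        using kN u v g by (simp add: m_assoc inv_solve_left)
      then have vN: "v \<in> N" using kN u y conj_N[OF g u(1)] by simp
      have "y \<otimes> g = k \<otimes> (D g u \<otimes> v \<otimes> g)"
        using \<open>y \<otimes> g = k \<otimes> (u \<otimes> (v \<otimes> g) \<otimes> inv (\<phi> u))\<close> twist_by_N[OF g vN u(1)] by simp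
      then have "y \<otimes> g = D g u \<otimes> k \<otimes> v \<otimes> g"
        using N_comm[OF D_in_N[OF g u(1)] kN] kN D_in_N[OF g u(1)] vN g by (simp add: m_assoc)
      then have "y = D g u \<otimes> k \<otimes> v"
        using kN D_in_N[OF g u(1)] vN g y by simp
      then have "L #>\<^bsub>NG\<^esub> y = L #>\<^bsub>NG\<^esub> w C"
        using Leq[OF y vN] u z by (auto simp: v_def)
      then show "L #>\<^bsub>NG\<^esub> y \<in> (\<lambda>C. L #>\<^bsub>NG\<^esub> w C) ` (rcosets N)" using C by blast
    qed
    then show "card ((\<lambda>x. L #>\<^bsub>NG\<^esub> x) ` {y \<in> A. F (y \<otimes> g) = F (x \<otimes> g)}) \<le> card (rcosets N)"
      using card_mono card_image_le fin_index by (meson finite_imageI le_trans)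
  qed
qed

end

section \<open>Word balls and Schreier generators\<close>

definition words_upto :: "('a, 'b) monoid_scheme \<Rightarrow> 'a set \<Rightarrow> nat \<Rightarrow> 'a set" where
  "words_upto G S r = {foldr (\<otimes>\<^bsub>G\<^esub>) ws \<one>\<^bsub>G\<^esub> | ws.
     length ws \<le> r \<and> set ws \<subseteq> S \<union> (\<lambda>s. inv\<^bsub>G\<^esub> s) ` S}"

context group
begin

lemma foldr_mult_closed:
  "set ws \<subseteq> carrier G \<Longrightarrow> foldr (\<otimes>) ws \<one> \<in> carrier G"
  by (induction ws) auto

lemma foldr_mult_append:
  assumes "set ws \<subseteq> carrier G" "set vs \<subseteq> carrier G"
  shows "foldr (\<otimes>) (ws @ vs) \<one> = foldr (\<otimes>) ws \<one> \<otimes> foldr (\<otimes>) vs \<one>"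
  using assms(1)
proof (induction ws)
  case Nil
  then show ?case using foldr_mult_closed[OF assms(2)] by simp
next
  case (Cons w ws)
  then show ?case
    using foldr_mult_closed[OF assms(2)] foldr_mult_closed[of ws] by (simp add: m_assoc)
qed

lemma letters_closed:
  "S \<subseteq> carrier G \<Longrightarrow> S \<union> (\<lambda>s. inv s) ` S \<subseteq> carrier G"
  by auto

lemma words_upto_mono: "m \<le> n \<Longrightarrow> words_upto G S m \<subseteq> words_upto G S n"
  unfolding words_upto_def by fastforce

lemma words_upto_closed: "S \<subseteq> carrier G \<Longrightarrow> words_upto G S r \<subseteq> carrier G"
  unfolding words_upto_def using foldr_mult_closed letters_closed by blast

lemma one_in_words_upto: "\<one> \<in> words_upto G S r"
  unfolding words_upto_def by (rule CollectI, rule exI[of _ "[]"]) simp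

lemma words_upto_mult:
  assumes S: "S \<subseteq> carrier G" and "x \<in> words_upto G S m" "y \<in> words_upto G S n"
  shows "x \<otimes> y \<in> words_upto G S (m + n)"
proof -
  obtain ws vs where ws: "length ws \<le> m" "set ws \<subseteq> S \<union> (\<lambda>s. inv s) ` S" "x = foldr (\<otimes>) ws \<one>"
    and vs: "length vs \<le> n" "set vs \<subseteq> S \<union> (\<lambda>s. inv s) ` S" "y = foldr (\<otimes>) vs \<one>"
    using assms(2,3) unfolding words_upto_def by blast
  have "set ws \<subseteq> carrier G" "set vs \<subseteq> carrier G"
    using ws(2) vs(2) letters_closed[OF S] by (meson subset_trans)+
  then have "x \<otimes> y = foldr (\<otimes>) (ws @ vs) \<one>"
    using foldr_mult_append[of ws vs] ws(3) vs(3) by simp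
  moreover have "length (ws @ vs) \<le> m + n" "set (ws @ vs) \<subseteq> S \<union> (\<lambda>s. inv s) ` S"
    using ws(1,2) vs(1,2) by auto
  ultimately show ?thesis unfolding words_upto_def by blast
qed

lemma words_upto_pow:
  assumes S: "S \<subseteq> carrier G" and x: "x \<in> words_upto G S m"
  shows "x [^] (n::nat) \<in> words_upto G S (n * m)"
proof (induction n)
  case 0
  then show ?case by (simp add: one_in_words_upto)
next
  case (Suc n)
  then show ?case
    using words_upto_mult[OF S Suc x] by (simp add: add.commute)
qed

lemma generate_imp_word:
  assumes S: "S \<subseteq> carrier G" and "g \<in> generate G S"
  shows "\<exists>r. g \<in> words_upto G S r"
  using assms(2)
proof (induction rule: generate.induct)
  case one
  then show ?case using one_in_words_upto by blast
next
  case (incl h)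
  have "h = foldr (\<otimes>) [h] \<one>" using incl S by auto
  then show ?case unfolding words_upto_def using incl
    by (intro exI[of _ 1] CollectI exI[of _ "[h]"]) auto
next
  case (inv h)
  have "inv h = foldr (\<otimes>) [inv h] \<one>" using inv S by auto
  then show ?case unfolding words_upto_def using inv
    by (intro exI[of _ 1] CollectI exI[of _ "[inv h]"]) auto
next
  case (eng h1 h2)
  then show ?case using words_upto_mult[OF S] by blast
qed

lemma word_ball_eq_words_upto:
  assumes S: "S \<subseteq> carrier G" and gen: "generate G S = carrier G"
  shows "word_ball G S r = words_upto G S r"
proof
  let ?P = "\<lambda>g k. \<exists>ws. length ws = k \<and> set ws \<subseteq> S \<union> (\<lambda>s. inv s) ` S \<and> foldr (\<otimes>) ws \<one> = g"
  have wl: "word_length G S g = (LEAST k. ?P g k)" for g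
    unfolding word_length_def by simp
  show "words_upto G S r \<subseteq> word_ball G S r"
  proof
    fix g assume g: "g \<in> words_upto G S r"
    then obtain ws where ws: "length ws \<le> r" "set ws \<subseteq> S \<union> (\<lambda>s. inv s) ` S"
        "foldr (\<otimes>) ws \<one> = g"
      unfolding words_upto_def by blast
    then have "?P g (length ws)" by (intro exI[of _ ws] conjI refl)
    then have "(LEAST k. ?P g k) \<le> length ws" by (rule Least_le)
    with ws(1) have "word_length G S g \<le> r" unfolding wl by linarith
    then show "g \<in> word_ball G S r"
      unfolding word_ball_def using g words_upto_closed[OF S] by blast
  qed
  show "word_ball G S r \<subseteq> words_upto G S r"
  proof
    fix g assume "g \<in> word_ball G S r"
    then have g: "g \<in> carrier G" "word_length G S g \<le> r" by (auto simp: word_ball_def)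
    then obtain s where "g \<in> words_upto G S s" using generate_imp_word[OF S] gen by blast
    then have "\<exists>k. ?P g k" unfolding words_upto_def by blast
    then have "?P g (word_length G S g)" unfolding wl by (rule LeastI_ex)
    then obtain ws where "length ws = word_length G S g" "set ws \<subseteq> S \<union> (\<lambda>s. inv s) ` S"
        "foldr (\<otimes>) ws \<one> = g"
      by blast
    then show "g \<in> words_upto G S r"
      unfolding words_upto_def using g(2) by (intro CollectI exI[of _ ws]) simp
  qed
qed

end

locale generated_virtually_abelian_endo = virtually_abelian_endo +
  fixes S
  assumes fin_S: "finite S" and S: "S \<subseteq> carrier G" and gen_S: "generate G S = carrier G"
    and tf: "torsion_free (G\<lparr>carrier := N\<rparr>)"
begin

text \<open>
  Combinations with exponents up to \<open>p\<close> have word length linear in \<open>p\<close>; the constant is the total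
  length of words for the elements of \<open>E\<close>.
\<close>

lemma lincomb_in_words_upto:
  assumes E: "finite E" "E \<subseteq> N"
  shows "\<exists>C. \<forall>p b. (\<forall>e\<in>E. 0 \<le> b e \<and> b e \<le> int p) \<longrightarrow> lincomb NG E b \<in> words_upto G S (p * C)"
  using E
proof (induction E)
  case empty
  then show ?case using one_in_words_upto NG.lincomb_empty by simp
next
  case (insert e E)
  then obtain C where C: "\<And>p b. (\<forall>e\<in>E. 0 \<le> b e \<and> b e \<le> int p) \<Longrightarrow>
      lincomb NG E b \<in> words_upto G S (p * C)" by auto
  have "e \<in> generate G S" using insert.prems gen_S by simp
  then obtain m where m: "e \<in> words_upto G S m" using generate_imp_word[OF S] by blast
  show ?case
  proof (intro exI[of _ "m + C"] allI impI)
    fix p :: nat and b assume b: "\<forall>x\<in>insert e E. 0 \<le> b x \<and> b x \<le> int p"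
    have "e [^]\<^bsub>NG\<^esub> b e = e [^] nat (b e)"
      using b insert.prems int_pow_int[of G e "nat (b e)"]
        int_pow_consistent[OF is_subgroup, of e "b e"] by simp
    moreover have "e [^] nat (b e) \<in> words_upto G S (nat (b e) * m)"
      by (rule words_upto_pow[OF S m])
    moreover have "nat (b e) * m \<le> p * m" using b by (intro mult_right_mono) auto
    ultimately have "e [^]\<^bsub>NG\<^esub> b e \<in> words_upto G S (p * m)"
      using words_upto_mono[of "nat (b e) * m" "p * m" S] by auto
    then have "e [^]\<^bsub>NG\<^esub> b e \<otimes> lincomb NG E b \<in> words_upto G S (p * m + p * C)"
      using b by (intro words_upto_mult[OF S] C) auto
    then show "lincomb NG (insert e E) b \<in> words_upto G S (p * (m + C))"
      using insert NG.lincomb_insert[of E e b] by (simp add: algebra_simps)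
  qed
qed

definition transversal :: "('a set \<Rightarrow> 'a) \<Rightarrow> bool" where
  "transversal \<rho> \<longleftrightarrow> (\<forall>C\<in>rcosets N. \<rho> C \<in> C) \<and> \<rho> N = \<one>"

lemma transversal_ex: "\<exists>\<rho>. transversal \<rho>"
proof -
  have "(SOME t. t \<in> C) \<in> C" if "C \<in> rcosets N" for C
    using rcosets_non_empty[OF that] by (simp add: some_in_eq)
  then have "transversal (\<lambda>C. if C = N then \<one> else SOME t. t \<in> C)"
    unfolding transversal_def by simp
  then show ?thesis by blast
qed

lemma transversal_rcos:
  assumes "transversal \<rho>" "C \<in> rcosets N"
  shows "\<rho> C \<in> carrier G" "N #> \<rho> C = C"
proof -
  have mem: "\<rho> C \<in> C" using assms by (auto simp: transversal_def)
  then show c: "\<rho> C \<in> carrier G" using rcosets_carrier[OF is_group assms(2)] by blast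
  obtain g where "g \<in> carrier G" "C = N #> g" using assms(2) by (auto simp: RCOSETS_def)
  then show "N #> \<rho> C = C" using repr_independence[of "\<rho> C" N g] mem is_subgroup by simp
qed

lemma N_times_rcos:
  assumes "n \<in> N" "g \<in> carrier G"
  shows "N #> (n \<otimes> g) = N #> g"
  using assms by (subst rcos_eq_iff[OF is_subgroup]) auto

text \<open>
  The set \<open>Y\<close> consists of the Schreier generators \<open>t s \<sigma>(t s)\<inverse>\<close>, with \<open>t\<close> in the transversal, \<open>s\<close> a
  letter and \<open>\<sigma>\<close> the choice of representatives. Reading a word from the left, each letter
  contributes one of them, so a word of length \<open>r\<close> that represents \<open>x \<rho>(C)\<close> yields \<open>x\<close> as a product of
  at most \<open>r\<close> elements of \<open>Y\<close>. This uses that \<open>\<rho> N = \<one>\<close>: the reading starts at the trivial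
  representative.
\<close>

lemma schreier:
  assumes \<rho>: "transversal \<rho>"
  shows "\<exists>Y. finite Y \<and> Y \<subseteq> N \<and> (\<forall>C\<in>rcosets N. \<forall>r. \<forall>x\<in>N. x \<otimes> \<rho> C \<in> words_upto G S r \<longrightarrow>
    (\<exists>a. (\<forall>y\<in>Y. \<bar>a y\<bar> \<le> int r) \<and> x = lincomb NG Y a))"
proof -
  define \<sigma> where "\<sigma> g = \<rho> (N #> g)" for g
  let ?A = "S \<union> (\<lambda>s. inv s) ` S"
  define y where "y C s = \<rho> C \<otimes> s \<otimes> inv (\<sigma> (\<rho> C \<otimes> s))" for C s
  define Y where "Y = (\<lambda>(C, s). y C s) ` ((rcosets N) \<times> ?A)"
  have finY: "finite Y" unfolding Y_def using fin_index fin_S by simp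
  have cos: "N #> g \<in> rcosets N" if "g \<in> carrier G" for g
    using that subset by (simp add: rcosetsI)
  have \<sigma>: "\<sigma> g \<in> carrier G" "N #> \<sigma> g = N #> g" if "g \<in> carrier G" for g
    using transversal_rcos[OF \<rho> cos[OF that]] by (auto simp: \<sigma>_def)
  have \<sigma>N: "g \<otimes> inv (\<sigma> g) \<in> N" if g: "g \<in> carrier G" for g
    using rcos_module[OF is_group \<sigma>(1)[OF g] g] \<sigma>(2)[OF g] rcos_self[OF g is_subgroup] by simp
  have yN: "y C s \<in> N" if "C \<in> rcosets N" "s \<in> ?A" for C s
    unfolding y_def using that transversal_rcos[OF \<rho>] letters_closed[OF S] by (intro \<sigma>N) auto
  have YN: "Y \<subseteq> N" unfolding Y_def using yN by auto
  have main: "\<exists>a. (\<forall>u\<in>Y. 0 \<le> a u \<and> a u \<le> int (length ws)) \<and>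
      \<rho> C \<otimes> foldr (\<otimes>) ws \<one> = lincomb NG Y a \<otimes> \<sigma> (\<rho> C \<otimes> foldr (\<otimes>) ws \<one>)"
    if "set ws \<subseteq> ?A" "C \<in> rcosets N" for ws C
    using that
  proof (induction ws arbitrary: C)
    case Nil
    note r = transversal_rcos[OF \<rho> Nil(2)]
    have "lincomb NG Y (\<lambda>_. 0) = \<one>" using NG.lincomb_zero[of Y] by simp
    then show ?case using r by (intro exI[of _ "\<lambda>_. 0"]) (simp add: \<sigma>_def)
  next
    case (Cons s ws)
    let ?w = "foldr (\<otimes>) ws \<one>"
    define c where "c = \<rho> C"
    have c: "c \<in> carrier G" using transversal_rcos[OF \<rho> Cons.prems(2)] by (simp add: c_def)
    have s: "s \<in> ?A" "s \<in> carrier G" using Cons.prems letters_closed[OF S] by auto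
    have w: "?w \<in> carrier G"
      using Cons.prems letters_closed[OF S] by (intro foldr_mult_closed) auto
    define d where "d = \<sigma> (c \<otimes> s)"
    have d: "d \<in> carrier G" using \<sigma> c s by (simp add: d_def)
    define u where "u = y C s"
    have u: "u \<in> N" "u \<in> Y" using yN[OF Cons.prems(2) s(1)] Cons.prems(2) s(1)
      by (auto simp: u_def Y_def)
    have cs: "c \<otimes> s = u \<otimes> d" using c s d by (simp add: u_def y_def m_assoc flip: c_def d_def)
    obtain a where a: "\<forall>v\<in>Y. 0 \<le> a v \<and> a v \<le> int (length ws)"
        "d \<otimes> ?w = lincomb NG Y a \<otimes> \<sigma> (d \<otimes> ?w)"
      using Cons.IH[of "N #> (c \<otimes> s)"] Cons.prems cos[of "c \<otimes> s"] c s
      by (auto simp: d_def \<sigma>_def)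
    define a' where "a' v = (if v = u then 1 else 0) + a v" for v
    have csw: "c \<otimes> (s \<otimes> ?w) = u \<otimes> (d \<otimes> ?w)"
      using cs c s w d u by (metis m_assoc mem_carrier)
    then have \<sigma>eq: "\<sigma> (c \<otimes> (s \<otimes> ?w)) = \<sigma> (d \<otimes> ?w)"
      using N_times_rcos[OF u(1)] d w by (simp add: \<sigma>_def)
    have "lincomb NG Y a' = lincomb NG Y (\<lambda>v. if v = u then 1 else 0) \<otimes> lincomb NG Y a"
      unfolding a'_def using NG.lincomb_add[of Y "\<lambda>v. if v = u then 1 else 0" a] YN by simp
    also have "lincomb NG Y (\<lambda>v. if v = u then 1 else 0) = u"
      using NG.lincomb_delta[of Y u 1] NG.int_pow_1[of u] finY YN u by simp
    finally have "lincomb NG Y a' \<otimes> \<sigma> (c \<otimes> (s \<otimes> ?w)) = u \<otimes> (lincomb NG Y a \<otimes> \<sigma> (d \<otimes> ?w))"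
      unfolding \<sigma>eq using u \<sigma>(1)[of "d \<otimes> ?w"] d w NG.lincomb_closed[of Y a] YN
      by (simp add: m_assoc)
    then have "c \<otimes> (s \<otimes> ?w) = lincomb NG Y a' \<otimes> \<sigma> (c \<otimes> (s \<otimes> ?w))"
      using csw a(2) by simp
    moreover have "\<forall>v\<in>Y. 0 \<le> a' v \<and> a' v \<le> int (length (s # ws))"
      using a(1) by (auto simp: a'_def)
    ultimately show ?case by (auto simp flip: c_def)
  qed
  have "\<exists>a. (\<forall>u\<in>Y. \<bar>a u\<bar> \<le> int r) \<and> x = lincomb NG Y a"
    if C: "C \<in> rcosets N" and x: "x \<in> N" "x \<otimes> \<rho> C \<in> words_upto G S r" for C r x
  proof -
    note t = transversal_rcos[OF \<rho> C]
    obtain ws where ws: "length ws \<le> r" "set ws \<subseteq> ?A" "x \<otimes> \<rho> C = foldr (\<otimes>) ws \<one>"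
      using x(2) unfolding words_upto_def by blast
    have "\<rho> N = \<one>" using \<rho> by (simp add: transversal_def)
    moreover have "N \<in> rcosets N" by (rule subgroup_in_rcosets[OF is_group])
    ultimately obtain a where a: "\<forall>u\<in>Y. 0 \<le> a u \<and> a u \<le> int (length ws)"
        "\<one> \<otimes> (x \<otimes> \<rho> C) = lincomb NG Y a \<otimes> \<sigma> (\<one> \<otimes> (x \<otimes> \<rho> C))"
      using main[OF ws(2), of N] ws(3) by auto
    have "\<sigma> (x \<otimes> \<rho> C) = \<rho> C" using N_times_rcos[OF x(1) t(1)] t(2) by (simp add: \<sigma>_def)
    then have "x \<otimes> \<rho> C = lincomb NG Y a \<otimes> \<rho> C" using a(2) x(1) t(1) by simp
    then have "x = lincomb NG Y a" using x(1) t(1) NG.lincomb_closed[of Y a] YN by simp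
    moreover have "\<bar>a u\<bar> \<le> int r" if "u \<in> Y" for u
    proof -
      have "0 \<le> a u \<and> a u \<le> int (length ws)" using a(1) that by blast
      then show ?thesis using ws(1) by linarith
    qed
    ultimately show ?thesis by blast
  qed
  then show ?thesis using finY YN by (intro exI[of _ Y]) blast
qed

lemma generate_N_of_lincomb:
  assumes "finite Y" "Y \<subseteq> N" and "\<And>x. x \<in> N \<Longrightarrow> \<exists>a. x = lincomb NG Y a"
  shows "generate NG Y = carrier NG"
proof -
  have "N \<subseteq> range (lincomb NG Y)" using assms(3) by blast
  moreover have "range (lincomb NG Y) \<subseteq> N" using NG.lincomb_closed[of Y] assms(2) by auto
  ultimately show ?thesis using NG.generate_eq_range_lincomb[of Y] assms(1,2) by simp
qed

lemma growth_data_ex: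
  "\<exists>\<rho> Y E M. transversal \<rho> \<and> finite Y \<and> Y \<subseteq> N \<and> generate NG Y = carrier NG \<and>
     (\<forall>C\<in>rcosets N. \<forall>r. \<forall>x\<in>N. x \<otimes> \<rho> C \<in> words_upto G S r \<longrightarrow>
        (\<exists>a. (\<forall>y\<in>Y. \<bar>a y\<bar> \<le> int r) \<and> x = lincomb NG Y a)) \<and>
     (\<forall>C\<in>rcosets N. quasi_basis NG (twist_image (\<rho> C)) (E C) (M C))"
proof -
  obtain \<rho> where \<rho>: "transversal \<rho>" using transversal_ex by blast
  obtain Y where Y: "finite Y" "Y \<subseteq> N" and sch: "\<forall>C\<in>rcosets N. \<forall>r. \<forall>x\<in>N.
      x \<otimes> \<rho> C \<in> words_upto G S r \<longrightarrow> (\<exists>a. (\<forall>y\<in>Y. \<bar>a y\<bar> \<le> int r) \<and> x = lincomb NG Y a)"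
    using schreier[OF \<rho>] by blast
  have gen: "generate NG Y = carrier NG"
  proof (rule generate_N_of_lincomb[OF Y])
    fix x assume x: "x \<in> N"
    then have "x \<in> generate G S" using gen_S by simp
    then obtain r where "x \<in> words_upto G S r" using generate_imp_word[OF S] by blast
    moreover have "x \<otimes> \<rho> N = x" using \<rho> x by (simp add: transversal_def)
    ultimately show "\<exists>a. x = lincomb NG Y a"
      using sch x subgroup_in_rcosets[OF is_group] by metis
  qed
  have "\<exists>E M. quasi_basis NG (twist_image (\<rho> C)) E M" if C: "C \<in> rcosets N" for C
    using Y gen twist_image_subgroup[OF transversal_rcos(1)[OF \<rho> C]]
    by (intro NG.quasi_basis_ex[of Y]) auto
  then obtain E M where "\<forall>C\<in>rcosets N. quasi_basis NG (twist_image (\<rho> C)) (E C) (M C)"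
    by metis
  then show ?thesis using \<rho> Y gen sch by blast
qed

end

section \<open>The exponent and the two growth functions\<close>

text \<open>
  The choices on which the counting depends, fixed once: a transversal, Schreier generators of \<open>N\<close>,
  and for every coset a quasi-basis of \<open>N\<close> modulo the image of the corresponding \<open>D g\<close>.
\<close>

locale growth_data = generated_virtually_abelian_endo +
  fixes \<rho> Y E M
  assumes \<rho>: "transversal \<rho>" and fin_Y: "finite Y" and Y: "Y \<subseteq> N"
    and gen_Y: "generate (G\<lparr>carrier := N\<rparr>) Y = N"
    and schreier_Y: "\<And>C r x. C \<in> rcosets N \<Longrightarrow> x \<in> N \<Longrightarrow> x \<otimes> \<rho> C \<in> words_upto G S r \<Longrightarrow>
        \<exists>a. (\<forall>y\<in>Y. \<bar>a y\<bar> \<le> int r) \<and> x = lincomb (G\<lparr>carrier := N\<rparr>) Y a"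
    and qb: "\<And>C. C \<in> rcosets N \<Longrightarrow>
        quasi_basis (G\<lparr>carrier := N\<rparr>) (twist_image (\<rho> C)) (E C) (M C)"
begin

lemma \<rho>_closed: "C \<in> rcosets N \<Longrightarrow> \<rho> C \<in> carrier G"
  using transversal_rcos(1)[OF \<rho>] .

text \<open>
  All representatives of \<open>C\<close> induce the same \<open>D g\<close> on \<open>N\<close> (\<open>D_coset_invariant\<close>), so the rank attached
  to \<open>C\<close> may be computed at \<open>\<rho> C\<close>, where \<open>quasi_basis_rank\<close> applies.
\<close>

lemma free_rank_N:
  assumes C: "C \<in> rcosets N"
  shows "free_rank NG = coset_rank G N \<phi> C + card (E C)"
proof -
  note t = transversal_rcos[OF \<rho> C]
  interpret h: group_hom NG NG "D (\<rho> C)" by unfold_locales (rule D_hom[OF t(1)])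
  have "endo_rank G N (D g) = endo_rank G N (D (\<rho> C))" if "g \<in> C" for g
  proof -
    have "g \<in> N #> \<rho> C" using that t(2) by simp
    then obtain x where x: "x \<in> N" "g = x \<otimes> \<rho> C" by (auto simp: r_coset_def)
    then have "D g ` N = D (\<rho> C) ` N"
      using D_coset_invariant[OF t(1)] by (intro image_cong) auto
    then show ?thesis by (simp add: endo_rank_def)
  qed
  then have "(\<lambda>g. endo_rank G N (D g)) ` C = (\<lambda>_. endo_rank G N (D (\<rho> C))) ` C"
    by (intro image_cong) auto
  also have "\<dots> = {endo_rank G N (D (\<rho> C))}"
    using rcosets_non_empty[OF C] by (simp add: image_constant_conv)
  finally have "coset_rank G N \<phi> C = free_rank (G\<lparr>carrier := twist_image (\<rho> C)\<rparr>)"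
    by (simp add: coset_rank_def endo_rank_def twist_image_def)
  moreover have "generate NG (D (\<rho> C) ` Y) = twist_image (\<rho> C)"
    using h.generate_img[of Y] Y gen_Y by (simp add: twist_image_def)
  then have "free_rank NG = free_rank (NG\<lparr>carrier := twist_image (\<rho> C)\<rparr>) + card (E C)"
    using Y fin_Y gen_Y D_in_N[OF t(1)]
    by (intro NG.quasi_basis_rank[OF tf _ _ _ _ _ _ qb[OF C], of Y "D (\<rho> C) ` Y"]) auto
  ultimately show ?thesis by simp
qed

lemma card_le_growth_exponent: "C \<in> rcosets N \<Longrightarrow> card (E C) \<le> growth_exponent G N \<phi>"
  and growth_exponent_attained: "\<exists>C\<in>rcosets N. card (E C) = growth_exponent G N \<phi>"
proof -
  let ?R = "coset_rank G N \<phi> ` (rcosets N)"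
  have e: "growth_exponent G N \<phi> = free_rank NG - Min ?R"
    by (simp add: growth_exponent_def FactGroup_def)
  have ne: "?R \<noteq> {}" using subgroup_in_rcosets[OF is_group] by blast
  show "card (E C) \<le> growth_exponent G N \<phi>" if C: "C \<in> rcosets N" for C
  proof -
    have "Min ?R \<le> coset_rank G N \<phi> C" using fin_index C by (intro Min_le) auto
    then show ?thesis using free_rank_N[OF C] unfolding e by linarith
  qed
  have "Min ?R \<in> ?R" using fin_index ne by (intro Min_in) auto
  then obtain C where C: "C \<in> rcosets N" "Min ?R = coset_rank G N \<phi> C" by blast
  then have "card (E C) = growth_exponent G N \<phi>" using free_rank_N[OF C(1)] e by simp
  then show "\<exists>C\<in>rcosets N. card (E C) = growth_exponent G N \<phi>" using C(1) by blast
qed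

text \<open>
  Splitting \<open>B\<close> along the cosets of \<open>N\<close>: a bound with exponent \<open>card (E C)\<close> on each coset becomes
  a bound with the largest of these exponents.
\<close>

lemma card_le_sum_cosets:
  assumes "B \<subseteq> carrier G"
    and "\<And>C. C \<in> rcosets N \<Longrightarrow> finite ((\<lambda>x. F (x \<otimes> \<rho> C)) ` {x \<in> N. x \<otimes> \<rho> C \<in> B})"
    and "\<And>C. C \<in> rcosets N \<Longrightarrow> card ((\<lambda>x. F (x \<otimes> \<rho> C)) ` {x \<in> N. x \<otimes> \<rho> C \<in> B}) \<le> U C * k ^ card (E C)"
    and k: "k \<ge> 1"
  shows "finite (F ` B)" and "card (F ` B) \<le> (\<Sum>C\<in>rcosets N. U C) * k ^ growth_exponent G N \<phi>"
proof -
  let ?A = "\<lambda>C. (\<lambda>x. F (x \<otimes> \<rho> C)) ` {x \<in> N. x \<otimes> \<rho> C \<in> B}"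
  have "F ` B \<subseteq> (\<Union>C\<in>rcosets N. ?A C)"
  proof safe
    fix g assume g: "g \<in> B"
    then have gc: "g \<in> carrier G" using assms(1) by blast
    have C: "N #> g \<in> rcosets N" using gc subset by (simp add: rcosetsI)
    note t = transversal_rcos[OF \<rho> C]
    have "g \<in> N #> \<rho> (N #> g)" using rcos_self[OF gc is_subgroup] t(2) by simp
    then obtain x where x: "x \<in> N" "g = x \<otimes> \<rho> (N #> g)" by (auto simp: r_coset_def)
    then have "F g \<in> ?A (N #> g)" using g by (metis (mono_tags, lifting) imageI mem_Collect_eq)
    then show "F g \<in> (\<Union>C\<in>rcosets N. ?A C)" using C by blast
  qed
  moreover have fin: "finite (\<Union>C\<in>rcosets N. ?A C)" using assms(2) fin_index by auto
  ultimately show "finite (F ` B)" and "card (F ` B) \<le> (\<Sum>C\<in>rcosets N. U C) * k ^ growth_exponent G N \<phi>"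
  proof -
    assume sub: "F ` B \<subseteq> (\<Union>C\<in>rcosets N. ?A C)"
    show "finite (F ` B)" using finite_subset[OF sub fin] .
    have "card (F ` B) \<le> card (\<Union>C\<in>rcosets N. ?A C)" using card_mono[OF fin sub] .
    also have "\<dots> \<le> (\<Sum>C\<in>rcosets N. card (?A C))" by (rule card_UN_le[OF fin_index])
    also have "\<dots> \<le> (\<Sum>C\<in>rcosets N. U C * k ^ growth_exponent G N \<phi>)"
    proof (rule sum_mono)
      fix C assume C: "C \<in> rcosets N"
      have "card (?A C) \<le> U C * k ^ card (E C)" by (rule assms(3)[OF C])
      also have "\<dots> \<le> U C * k ^ growth_exponent G N \<phi>"
        using card_le_growth_exponent[OF C] k by (intro mult_left_mono power_increasing) auto
      finally show "card (?A C) \<le> U C * k ^ growth_exponent G N \<phi>" .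
    qed
    finally show "card (F ` B) \<le> (\<Sum>C\<in>rcosets N. U C) * k ^ growth_exponent G N \<phi>"
      by (simp add: sum_distrib_right)
  qed
qed

end

context virtually_abelian_endo
begin

lemma power_subgroup_eq: "power_subgroup G N k = (\<lambda>x. x [^]\<^bsub>NG\<^esub> int k) ` carrier NG"
  by (auto simp: power_subgroup_def int_pow_int simp flip: nat_pow_consistent)

lemma power_subgroup_is_subgroup: "subgroup (power_subgroup G N k) NG"
  unfolding power_subgroup_eq by (rule NG.subgroup_powers)

lemma conj_nat_pow:
  assumes "g \<in> carrier G" "x \<in> carrier G"
  shows "g \<otimes> x [^] (n::nat) \<otimes> inv g = (g \<otimes> x \<otimes> inv g) [^] n"
proof (induction n)
  case (Suc n)
  have "g \<otimes> x [^] Suc n \<otimes> inv g = (g \<otimes> x [^] n \<otimes> inv g) \<otimes> (g \<otimes> x \<otimes> inv g)"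
    using assms by (simp add: m_assoc inv_solve_left)
  then show ?case using Suc by simp
qed (use assms in simp)

lemma power_subgroup_invariant_normal: "invariant_normal (power_subgroup G N k) G \<phi>"
proof -
  have "power_subgroup G N k \<lhd> G"
    unfolding normal_inv_iff
  proof (intro conjI ballI)
    show "subgroup (power_subgroup G N k) G"
      using incl_subgroup[OF is_subgroup power_subgroup_is_subgroup] .
    fix g h assume g: "g \<in> carrier G" and "h \<in> power_subgroup G N k"
    then obtain x where x: "x \<in> N" "h = x [^] k" unfolding power_subgroup_def by blast
    have "g \<otimes> h \<otimes> inv g = (g \<otimes> x \<otimes> inv g) [^] k"
      using conj_nat_pow g x by simp
    moreover have "g \<otimes> x \<otimes> inv g \<in> N" using inv_op_closed2 g x by blast
    ultimately show "g \<otimes> h \<otimes> inv g \<in> power_subgroup G N k"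
      unfolding power_subgroup_def by blast
  qed
  moreover have "\<phi> ` power_subgroup G N k \<subseteq> power_subgroup G N k"
  proof safe
    fix h assume "h \<in> power_subgroup G N k"
    then obtain x where x: "x \<in> N" "h = x [^] k" unfolding power_subgroup_def by blast
    then have "\<phi> h = \<phi> x [^] k" "\<phi> x \<in> N" using phi.hom_nat_pow phi_N by auto
    then show "\<phi> h \<in> power_subgroup G N k" unfolding power_subgroup_def by blast
  qed
  ultimately show ?thesis
    by (intro invariant_normal.intro invariant_normal_axioms.intro endo)
qed

text \<open>
  For trivial \<open>K\<close> this says that \<open>F\<close> classifies the twisted classes of \<open>G\<close>, and for \<open>K = N\<^sup>k\<close> that it
  classifies those of the quotient by \<open>N\<^sup>k\<close>.
\<close>

definition separates :: "('a \<Rightarrow> 'c) \<Rightarrow> 'a set \<Rightarrow> bool" where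
  "separates F K \<longleftrightarrow> (\<forall>a\<in>carrier G. \<forall>b\<in>carrier G.
     F a = F b \<longleftrightarrow> (\<exists>z\<in>carrier G. \<exists>h\<in>K. a = h \<otimes> (z \<otimes> b \<otimes> inv (\<phi> z))))"

lemma quotient_growth_separates:
  "\<exists>F :: 'a \<Rightarrow> 'a set set. quotient_growth G N \<phi> k = card (F ` carrier G) \<and>
     separates F (power_subgroup G N k)"
proof -
  interpret K: invariant_normal "power_subgroup G N k" G \<phi>
    by (rule power_subgroup_invariant_normal)
  show ?thesis
    unfolding quotient_growth_def K.reidemeister_number_quotient separates_def
    by (rule exI[of _ "\<lambda>g. twisted_class (G Mod power_subgroup G N k)
          (induced_map G (power_subgroup G N k) \<phi>) (power_subgroup G N k #> g)"])
      (intro conjI refl ballI K.quotient_class_eq_iff)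
qed

lemma twisted_class_separates: "separates (twisted_class G \<phi>) {\<one>}"
  unfolding separates_def using twisted_class_eq_iff[OF endo] by simp

end

context growth_data
begin

lemma sublattice_properties:
  fixes k :: nat
  assumes "C \<in> rcosets N"
  defines "L \<equiv> twist_image (\<rho> C)"
  defines "L' \<equiv> L <#>\<^bsub>NG\<^esub> power_subgroup G N k"
  shows "subgroup L NG" "subgroup L' NG" "L \<subseteq> L'" "\<forall>x\<in>carrier NG. x [^]\<^bsub>NG\<^esub> int k \<in> L'"
    and "x \<in> L' \<Longrightarrow> \<exists>y\<in>carrier NG. \<exists>l\<in>L. x = y [^]\<^bsub>NG\<^esub> int k \<otimes>\<^bsub>NG\<^esub> l"
proof -
  show L: "subgroup L NG" unfolding L_def by (rule twist_image_subgroup[OF \<rho>_closed[OF assms(1)]])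
  interpret L: subgroup L NG by fact
  interpret P: subgroup "power_subgroup G N k" NG by (rule power_subgroup_is_subgroup)
  show "subgroup L' NG"
    unfolding L'_def by (intro NG.mult_subgroups L power_subgroup_is_subgroup)
  show "L \<subseteq> L'"
  proof
    fix l assume l: "l \<in> L"
    then have "l = l \<otimes>\<^bsub>NG\<^esub> \<one>\<^bsub>NG\<^esub>" using L.mem_carrier[of l] NG.r_one[of l] by simp
    then show "l \<in> L'" unfolding L'_def set_mult_def using l P.one_closed by blast
  qed
  show "\<forall>x\<in>carrier NG. x [^]\<^bsub>NG\<^esub> int k \<in> L'"
  proof
    fix x assume x: "x \<in> carrier NG"
    then have "x [^]\<^bsub>NG\<^esub> int k = \<one>\<^bsub>NG\<^esub> \<otimes>\<^bsub>NG\<^esub> x [^]\<^bsub>NG\<^esub> int k"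
      using NG.l_one[OF NG.int_pow_closed[OF x]] by simp
    then show "x [^]\<^bsub>NG\<^esub> int k \<in> L'"
      unfolding L'_def set_mult_def power_subgroup_eq using x L.one_closed by blast
  qed
  show "\<exists>y\<in>carrier NG. \<exists>l\<in>L. x = y [^]\<^bsub>NG\<^esub> int k \<otimes>\<^bsub>NG\<^esub> l" if x: "x \<in> L'"
  proof -
    obtain l h where lh: "l \<in> L" "h \<in> power_subgroup G N k" "x = l \<otimes>\<^bsub>NG\<^esub> h"
      using x unfolding L'_def set_mult_def by blast
    obtain y where y: "y \<in> carrier NG" "h = y [^]\<^bsub>NG\<^esub> int k"
      using lh(2) unfolding power_subgroup_eq by (rule imageE)
    have "x = y [^]\<^bsub>NG\<^esub> int k \<otimes>\<^bsub>NG\<^esub> l"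
      unfolding lh(3) y(2) by (rule NG.m_comm[OF L.mem_carrier[OF lh(1)] NG.int_pow_closed[OF y(1)]])
    then show ?thesis using lh(1) y(1) by (intro bexI)
  qed
qed

lemma quotient_growth_upper:
  "\<exists>U. \<forall>k\<ge>1. \<forall>F :: 'a \<Rightarrow> 'd. separates F (power_subgroup G N k) \<longrightarrow>
     finite (F ` carrier G) \<and> card (F ` carrier G) \<le> U * k ^ growth_exponent G N \<phi>"
proof -
  have "\<exists>U. \<forall>k\<ge>1. \<forall>L'. subgroup L' NG \<longrightarrow> twist_image (\<rho> C) \<subseteq> L' \<longrightarrow>
      (\<forall>x\<in>carrier NG. x [^]\<^bsub>NG\<^esub> int k \<in> L') \<longrightarrow>
      finite ((\<lambda>x. L' #>\<^bsub>NG\<^esub> x) ` carrier NG) \<and>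
      card ((\<lambda>x. L' #>\<^bsub>NG\<^esub> x) ` carrier NG) \<le> U * k ^ card (E C)"
    if C: "C \<in> rcosets N" for C
    by (rule NG.card_rcosets_mod_powers_le[OF qb[OF C] fin_Y _ _ sublattice_properties(1)[OF C]])
      (use Y gen_Y in simp_all)
  then have "\<forall>C\<in>rcosets N. \<exists>U. \<forall>k\<ge>1. \<forall>L'. subgroup L' NG \<longrightarrow> twist_image (\<rho> C) \<subseteq> L' \<longrightarrow>
      (\<forall>x\<in>carrier NG. x [^]\<^bsub>NG\<^esub> int k \<in> L') \<longrightarrow>
      finite ((\<lambda>x. L' #>\<^bsub>NG\<^esub> x) ` carrier NG) \<and>
      card ((\<lambda>x. L' #>\<^bsub>NG\<^esub> x) ` carrier NG) \<le> U * k ^ card (E C)" ..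
  then obtain U where U: "\<forall>C\<in>rcosets N. \<forall>k\<ge>1. \<forall>L'. subgroup L' NG \<longrightarrow> twist_image (\<rho> C) \<subseteq> L' \<longrightarrow>
      (\<forall>x\<in>carrier NG. x [^]\<^bsub>NG\<^esub> int k \<in> L') \<longrightarrow>
      finite ((\<lambda>x. L' #>\<^bsub>NG\<^esub> x) ` carrier NG) \<and>
      card ((\<lambda>x. L' #>\<^bsub>NG\<^esub> x) ` carrier NG) \<le> U C * k ^ card (E C)"
    by (rule bchoice[THEN exE])
  have "finite (F ` carrier G) \<and>
      card (F ` carrier G) \<le> (\<Sum>C\<in>rcosets N. U C) * k ^ growth_exponent G N \<phi>"
    if k: "k \<ge> 1" and F: "separates F (power_subgroup G N k)" for k and F :: "'a \<Rightarrow> 'd"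
  proof -
    have *: "finite ((\<lambda>x. F (x \<otimes> \<rho> C)) ` {x \<in> N. x \<otimes> \<rho> C \<in> carrier G}) \<and>
        card ((\<lambda>x. F (x \<otimes> \<rho> C)) ` {x \<in> N. x \<otimes> \<rho> C \<in> carrier G}) \<le> U C * k ^ card (E C)"
      if C: "C \<in> rcosets N" for C
    proof -
      let ?L = "twist_image (\<rho> C) <#>\<^bsub>NG\<^esub> power_subgroup G N k"
      let ?A = "{x \<in> N. x \<otimes> \<rho> C \<in> carrier G}"
      have A: "?A = carrier NG" using \<rho>_closed[OF C] by auto
      have fin: "finite ((\<lambda>x. ?L #>\<^bsub>NG\<^esub> x) ` ?A)"
        and le: "card ((\<lambda>x. ?L #>\<^bsub>NG\<^esub> x) ` ?A) \<le> U C * k ^ card (E C)"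
        unfolding A using U[rule_format, OF C k sublattice_properties(2-3)[OF C, of k]]
          sublattice_properties(4)[OF C, of k] by blast+
      have "?A \<subseteq> N" by blast
      note b = twisted_classes_coset_bounds[OF \<rho>_closed[OF C] power_subgroup_is_subgroup
          F[unfolded separates_def, rule_format] this fin]
      show ?thesis using b(1,2) le by (meson le_trans)
    qed
    show ?thesis
      using card_le_sum_cosets[OF subset_refl, of F U k] * k by blast
  qed
  then show ?thesis by blast
qed

lemma quotient_growth_lower:
  "\<exists>B. \<forall>k\<ge>1. \<forall>F :: 'a \<Rightarrow> 'd. separates F (power_subgroup G N k) \<longrightarrow>
     k ^ growth_exponent G N \<phi> \<le> B * card (F ` carrier G)"
proof -
  obtain C where C: "C \<in> rcosets N" and e: "card (E C) = growth_exponent G N \<phi>"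
    using growth_exponent_attained by blast
  let ?m = "card (rcosets N)"
  have NG_gens: "Y \<subseteq> carrier NG" "generate NG Y = carrier NG" using Y gen_Y by simp_all
  obtain U where U: "\<forall>k\<ge>1. \<forall>L'. subgroup L' NG \<longrightarrow> twist_image (\<rho> C) \<subseteq> L' \<longrightarrow>
      (\<forall>x\<in>carrier NG. x [^]\<^bsub>NG\<^esub> int k \<in> L') \<longrightarrow>
      finite ((\<lambda>x. L' #>\<^bsub>NG\<^esub> x) ` carrier NG) \<and>
      card ((\<lambda>x. L' #>\<^bsub>NG\<^esub> x) ` carrier NG) \<le> U * k ^ card (E C)"
    using NG.card_rcosets_mod_powers_le[OF qb[OF C] fin_Y NG_gens sublattice_properties(1)[OF C]] ..
  obtain V where V: "\<forall>k\<ge>1. \<forall>F :: 'a \<Rightarrow> 'd. separates F (power_subgroup G N k) \<longrightarrow>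
     finite (F ` carrier G) \<and> card (F ` carrier G) \<le> V * k ^ growth_exponent G N \<phi>"
    using quotient_growth_upper ..
  have "k ^ growth_exponent G N \<phi> \<le> (nat (M C) ^ card (E C) * ?m) * card (F ` carrier G)"
    if k: "k \<ge> 1" and F: "separates F (power_subgroup G N k)" for k and F :: "'a \<Rightarrow> 'd"
  proof -
    let ?L = "twist_image (\<rho> C) <#>\<^bsub>NG\<^esub> power_subgroup G N k"
    note L0 = sublattice_properties(1)[OF C]
    note L = sublattice_properties(2-5)[OF C, where k = k]
    have fin: "finite ((\<lambda>x. ?L #>\<^bsub>NG\<^esub> x) ` carrier NG)"
      using U[rule_format, OF k L(1-2)] L(3) by blast
    have fin': "finite ((\<lambda>x. ?L #>\<^bsub>NG\<^esub> x) ` N)" using fin by simp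
    have "k ^ card (E C) \<le> nat (M C) ^ card (E C) * card ((\<lambda>x. ?L #>\<^bsub>NG\<^esub> x) ` carrier NG)"
      by (rule NG.power_le_card_rcosets_mod_powers[OF qb[OF C] L0 k L(1) L(4) fin])
    also have "carrier NG = N" by simp
    also have "nat (M C) ^ card (E C) * card ((\<lambda>x. ?L #>\<^bsub>NG\<^esub> x) ` N)
        \<le> nat (M C) ^ card (E C) * (?m * card ((\<lambda>x. F (x \<otimes> \<rho> C)) ` N))"
      by (intro mult_left_mono twisted_classes_coset_bounds(3)[OF \<rho>_closed[OF C]
          power_subgroup_is_subgroup F[unfolded separates_def, rule_format] subset_refl fin']) auto
    also have "card ((\<lambda>x. F (x \<otimes> \<rho> C)) ` N) \<le> card (F ` carrier G)"
    proof (rule card_mono)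
      show "finite (F ` carrier G)" using V k F by blast
      show "(\<lambda>x. F (x \<otimes> \<rho> C)) ` N \<subseteq> F ` carrier G" using \<rho>_closed[OF C] by auto
    qed
    finally show ?thesis by (simp add: e mult.assoc)
  qed
  then show ?thesis by blast
qed

lemma twist_image_set_mult_one:
  assumes "C \<in> rcosets N"
  shows "twist_image (\<rho> C) <#>\<^bsub>NG\<^esub> {\<one>} = twist_image (\<rho> C)"
  using sublattice_properties(1)[OF assms, THEN subgroup.subset]
  by (force simp: set_mult_def)

lemma twisted_growth_upper:
  "\<exists>U. \<forall>r\<ge>1. finite (twisted_class G \<phi> ` word_ball G S r) \<and>
     twisted_growth G S \<phi> r \<le> U * r ^ growth_exponent G N \<phi>"
proof -
  have "\<exists>U. \<forall>r\<ge>1.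
      finite ((\<lambda>a. twist_image (\<rho> C) #>\<^bsub>NG\<^esub> lincomb NG Y a) ` {a. \<forall>t\<in>Y. \<bar>a t\<bar> \<le> int r}) \<and>
      card ((\<lambda>a. twist_image (\<rho> C) #>\<^bsub>NG\<^esub> lincomb NG Y a) ` {a. \<forall>t\<in>Y. \<bar>a t\<bar> \<le> int r})
        \<le> U * r ^ card (E C)"
    if C: "C \<in> rcosets N" for C
    by (rule NG.card_rcosets_box_le[OF qb[OF C] sublattice_properties(1)[OF C] fin_Y])
      (use Y in simp)
  then have "\<forall>C\<in>rcosets N. \<exists>U. \<forall>r\<ge>1.
      finite ((\<lambda>a. twist_image (\<rho> C) #>\<^bsub>NG\<^esub> lincomb NG Y a) ` {a. \<forall>t\<in>Y. \<bar>a t\<bar> \<le> int r}) \<and>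
      card ((\<lambda>a. twist_image (\<rho> C) #>\<^bsub>NG\<^esub> lincomb NG Y a) ` {a. \<forall>t\<in>Y. \<bar>a t\<bar> \<le> int r})
        \<le> U * r ^ card (E C)" ..
  then obtain U where U: "\<forall>C\<in>rcosets N. \<forall>r\<ge>1.
      finite ((\<lambda>a. twist_image (\<rho> C) #>\<^bsub>NG\<^esub> lincomb NG Y a) ` {a. \<forall>t\<in>Y. \<bar>a t\<bar> \<le> int r}) \<and>
      card ((\<lambda>a. twist_image (\<rho> C) #>\<^bsub>NG\<^esub> lincomb NG Y a) ` {a. \<forall>t\<in>Y. \<bar>a t\<bar> \<le> int r})
        \<le> U C * r ^ card (E C)"
    by (rule bchoice[THEN exE])
  let ?F = "twisted_class G \<phi>" and ?B = "word_ball G S"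
  have "finite (?F ` ?B r) \<and> card (?F ` ?B r) \<le> (\<Sum>C\<in>rcosets N. U C) * r ^ growth_exponent G N \<phi>"
    if r: "r \<ge> 1" for r
  proof -
    have *: "finite ((\<lambda>x. ?F (x \<otimes> \<rho> C)) ` {x \<in> N. x \<otimes> \<rho> C \<in> ?B r}) \<and>
        card ((\<lambda>x. ?F (x \<otimes> \<rho> C)) ` {x \<in> N. x \<otimes> \<rho> C \<in> ?B r}) \<le> U C * r ^ card (E C)"
      if C: "C \<in> rcosets N" for C
    proof -
      let ?L = "twist_image (\<rho> C) <#>\<^bsub>NG\<^esub> {\<one>}"
      let ?A = "{x \<in> N. x \<otimes> \<rho> C \<in> ?B r}"
      let ?X = "(\<lambda>a. twist_image (\<rho> C) #>\<^bsub>NG\<^esub> lincomb NG Y a) ` {a. \<forall>t\<in>Y. \<bar>a t\<bar> \<le> int r}"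
      have X: "finite ?X" "card ?X \<le> U C * r ^ card (E C)" using U C r by auto
      have sub: "(\<lambda>x. ?L #>\<^bsub>NG\<^esub> x) ` ?A \<subseteq> ?X"
        unfolding twist_image_set_mult_one[OF C]
      proof (rule image_subsetI)
        fix x assume "x \<in> ?A"
        then obtain a where "\<forall>y\<in>Y. \<bar>a y\<bar> \<le> int r" "x = lincomb NG Y a"
          using schreier_Y[OF C] word_ball_eq_words_upto[OF S gen_S] by blast
        then show "twist_image (\<rho> C) #>\<^bsub>NG\<^esub> x \<in> ?X" by blast
      qed
      have fin: "finite ((\<lambda>x. ?L #>\<^bsub>NG\<^esub> x) ` ?A)" using finite_subset[OF sub X(1)] .
      have le: "card ((\<lambda>x. ?L #>\<^bsub>NG\<^esub> x) ` ?A) \<le> U C * r ^ card (E C)"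
        using card_mono[OF X(1) sub] X(2) by (rule le_trans)
      have "?A \<subseteq> N" by blast
      note b = twisted_classes_coset_bounds[OF \<rho>_closed[OF C] NG.triv_subgroup[simplified]
          twisted_class_separates[unfolded separates_def, rule_format] this fin]
      show ?thesis using b(1,2) le by (meson le_trans)
    qed
    have "?B r \<subseteq> carrier G" by (auto simp: word_ball_def)
    then show ?thesis
      using card_le_sum_cosets[of "?B r" ?F U r] * r by blast
  qed
  then show ?thesis unfolding twisted_growth_def by blast
qed

text \<open>
  In a coset whose exponent is largest, combinations of \<open>E C\<close> with exponents below a constant
  multiple of \<open>r\<close> lie in the ball of radius \<open>r\<close> and are pairwise distinct modulo the image of \<open>D\<close>.
\<close>

lemma twisted_growth_lower:
  "\<exists>B r0. \<forall>r\<ge>r0. r ^ growth_exponent G N \<phi> \<le> B * twisted_growth G S \<phi> r"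
proof -
  obtain C where C: "C \<in> rcosets N" and e: "card (E C) = growth_exponent G N \<phi>"
    using growth_exponent_attained by blast
  let ?m = "card (rcosets N)" and ?F = "twisted_class G \<phi>" and ?B = "word_ball G S"
  let ?L = "twist_image (\<rho> C) <#>\<^bsub>NG\<^esub> {\<one>}"
  have Eq: "finite (E C)" "E C \<subseteq> N" and ind: "indep_mod NG (twist_image (\<rho> C)) (E C)"
    using qb[OF C] by (auto simp: quasi_basis_def)
  note L = sublattice_properties(1)[OF C]
  obtain c where c: "\<forall>p b. (\<forall>e\<in>E C. 0 \<le> b e \<and> b e \<le> int p) \<longrightarrow>
      lincomb NG (E C) b \<in> words_upto G S (p * c)"
    using lincomb_in_words_upto[OF Eq] ..
  obtain w where w: "\<rho> C \<in> words_upto G S w"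
    using generate_imp_word[OF S] \<rho>_closed[OF C] gen_S by blast
  obtain U where U: "\<forall>r\<ge>1. finite (?F ` ?B r) \<and>
     twisted_growth G S \<phi> r \<le> U * r ^ growth_exponent G N \<phi>"
    using twisted_growth_upper ..
  define d where "d = Suc c"
  have "r ^ growth_exponent G N \<phi>
      \<le> ((2 * d) ^ growth_exponent G N \<phi> * ?m) * twisted_growth G S \<phi> r"
    if r: "r \<ge> 2 * (w + d)" for r
  proof -
    \<comment> \<open>Chosen so that words of length \<open>p * c\<close>, followed by the \<open>w\<close> letters of \<open>\<rho> C\<close>, fit into the ball;
      \<open>r \<ge> 2 * (w + d)\<close> makes \<open>p\<close> at least \<open>r / (2 * d)\<close>.\<close>
    define p where "p = (r - w) div d"
    have d: "d > 0" by (simp add: d_def)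
    have pd: "p * d \<le> r - w" unfolding p_def by (rule div_times_less_eq_dividend)
    have "r - w < p * d + d"
      unfolding p_def using dividend_less_div_times[OF d, of "r - w"] by simp
    then have "r < w + (p * d + d)" by linarith
    then have rp: "r \<le> 2 * d * p" using r by (simp add: algebra_simps)
    let ?P = "E C \<rightarrow>\<^sub>E {0..<int p}"
    let ?A = "lincomb NG (E C) ` ?P"
    have A: "?A \<subseteq> N" using NG.lincomb_closed[of "E C"] Eq(2) by auto
    have ball: "x \<otimes> \<rho> C \<in> ?B r" if x: "x \<in> ?A" for x
    proof -
      obtain b where b: "b \<in> ?P" "x = lincomb NG (E C) b" using x by blast
      have "0 \<le> b e \<and> b e \<le> int p" if "e \<in> E C" for e using PiE_mem[OF b(1) that] by simp
      then have "x \<in> words_upto G S (p * c)" using c b(2) by blast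
      then have "x \<otimes> \<rho> C \<in> words_upto G S (p * c + w)" using words_upto_mult[OF S _ w] by blast
      moreover have "p * c + w \<le> r"
      proof -
        have "p * c \<le> p * d" by (simp add: d_def)
        moreover have "p * d + w \<le> r" using pd r le_diff_conv2[of w r "p * d"] by simp
        ultimately show ?thesis by linarith
      qed
      ultimately show ?thesis
        using words_upto_mono[of "p * c + w" r S] word_ball_eq_words_upto[OF S gen_S] by auto
    qed
    have inj: "inj_on (\<lambda>b. twist_image (\<rho> C) #>\<^bsub>NG\<^esub> lincomb NG (E C) b) ?P"
      using ind by (intro NG.inj_on_rcoset_lincomb[OF Eq(1) _ L]) (use Eq(2) in \<open>auto simp: indep_mod_def\<close>)
    have img: "(\<lambda>x. ?L #>\<^bsub>NG\<^esub> x) ` ?A = (\<lambda>b. twist_image (\<rho> C) #>\<^bsub>NG\<^esub> lincomb NG (E C) b) ` ?P"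
      unfolding twist_image_set_mult_one[OF C] by (simp only: image_image)
    have fin: "finite ((\<lambda>x. ?L #>\<^bsub>NG\<^esub> x) ` ?A)"
      unfolding img using Eq(1) by (intro finite_imageI finite_PiE) auto
    have "p ^ card (E C) = card ?P" using Eq(1) by (simp add: card_PiE)
    also have "\<dots> = card ((\<lambda>x. ?L #>\<^bsub>NG\<^esub> x) ` ?A)" unfolding img using card_image[OF inj] by simp
    also have "\<dots> \<le> ?m * card ((\<lambda>x. ?F (x \<otimes> \<rho> C)) ` ?A)"
      by (rule twisted_classes_coset_bounds(3)[OF \<rho>_closed[OF C] NG.triv_subgroup[simplified]
          twisted_class_separates[unfolded separates_def, rule_format] A fin])
    also have "card ((\<lambda>x. ?F (x \<otimes> \<rho> C)) ` ?A) \<le> twisted_growth G S \<phi> r"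
      unfolding twisted_growth_def
    proof (rule card_mono)
      show "finite (?F ` ?B r)" using U r d by auto
      show "(\<lambda>x. ?F (x \<otimes> \<rho> C)) ` ?A \<subseteq> ?F ` ?B r" using ball by (intro image_subsetI imageI)
    qed
    finally have p: "p ^ card (E C) \<le> ?m * twisted_growth G S \<phi> r" by simp
    have "r ^ card (E C) \<le> (2 * d * p) ^ card (E C)" using rp by (rule power_mono) simp
    also have "\<dots> = (2 * d) ^ card (E C) * p ^ card (E C)" by (rule power_mult_distrib)
    also have "\<dots> \<le> (2 * d) ^ card (E C) * (?m * twisted_growth G S \<phi> r)"
      using p by (rule mult_left_mono) simp
    finally show ?thesis by (simp only: e mult.assoc)
  qed
  then show ?thesis by blast
qed

end

lemma bigtheta_power_nat:
  fixes f :: "nat \<Rightarrow> nat"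
  assumes up: "\<forall>k\<ge>1. f k \<le> U * k ^ e" and low: "\<forall>k\<ge>m. k ^ e \<le> B * f k"
  shows "(\<lambda>k. real (f k)) \<in> \<Theta>(\<lambda>k. real k ^ e)"
proof (rule bigthetaI)
  show "(\<lambda>k. real (f k)) \<in> O(\<lambda>k. real k ^ e)"
  proof (rule bigoI)
    show "\<forall>\<^sub>F k in at_top. norm (real (f k)) \<le> real U * norm (real k ^ e)"
      using eventually_ge_at_top[of 1]
    proof eventually_elim
      case (elim k)
      then have "real (f k) \<le> real (U * k ^ e)" using up by (intro of_nat_mono) auto
      then show ?case by simp
    qed
  qed
  have "(\<lambda>k. real k ^ e) \<in> O(\<lambda>k. real (f k))"
  proof (rule bigoI)
    show "\<forall>\<^sub>F k in at_top. norm (real k ^ e) \<le> real B * norm (real (f k))"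
      using eventually_ge_at_top[of m]
    proof eventually_elim
      case (elim k)
      then have "real (k ^ e) \<le> real (B * f k)" using low by (intro of_nat_mono) auto
      then show ?case by simp
    qed
  qed
  then show "(\<lambda>k. real (f k)) \<in> \<Omega>(\<lambda>k. real k ^ e)" by (simp add: bigomega_iff_bigo)
qed

theorem theorem4:
  fixes G :: "('a, 'b) monoid_scheme" and S N :: "'a set" and \<phi> :: "'a \<Rightarrow> 'a"
  assumes "group G"
    and "virtually_abelian G"
    and "finite S" and "S \<subseteq> carrier G" and "generate G S = carrier G"
    and "N \<lhd> G" and "finite (rcosets\<^bsub>G\<^esub> N)"
    and "comm_group (G\<lparr>carrier := N\<rparr>)" and "torsion_free (G\<lparr>carrier := N\<rparr>)"
    and "\<phi> \<in> hom G G" and "\<phi> ` N \<subseteq> N"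
  shows "(\<lambda>k. real (quotient_growth G N \<phi> k)) \<in> \<Theta>(\<lambda>k. real (twisted_growth G S \<phi> k)) \<and>
         (\<lambda>k. real (twisted_growth G S \<phi> k)) \<in> \<Theta>(\<lambda>k. real k ^ growth_exponent G N \<phi>)"
proof -
  interpret generated_virtually_abelian_endo N G \<phi> S
    using assms by (intro generated_virtually_abelian_endo.intro virtually_abelian_endo.intro
        virtually_abelian_endo_axioms.intro generated_virtually_abelian_endo_axioms.intro)
  obtain \<rho> Y E M where "transversal \<rho>" "finite Y" "Y \<subseteq> N" "generate NG Y = carrier NG"
     "\<forall>C\<in>rcosets\<^bsub>G\<^esub> N. \<forall>r. \<forall>x\<in>N. x \<otimes>\<^bsub>G\<^esub> \<rho> C \<in> words_upto G S r \<longrightarrow>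
        (\<exists>a. (\<forall>y\<in>Y. \<bar>a y\<bar> \<le> int r) \<and> x = lincomb NG Y a)"
     "\<forall>C\<in>rcosets\<^bsub>G\<^esub> N. quasi_basis NG (twist_image (\<rho> C)) (E C) (M C)"
    using growth_data_ex by blast
  then interpret growth_data N G \<phi> S \<rho> Y E M
    by unfold_locales auto
  let ?e = "growth_exponent G N \<phi>"
  obtain U where U: "\<forall>k\<ge>1. \<forall>F :: 'a \<Rightarrow> 'a set set. separates F (power_subgroup G N k) \<longrightarrow>
     finite (F ` carrier G) \<and> card (F ` carrier G) \<le> U * k ^ ?e"
    using quotient_growth_upper ..
  obtain B where B: "\<forall>k\<ge>1. \<forall>F :: 'a \<Rightarrow> 'a set set. separates F (power_subgroup G N k) \<longrightarrow>
     k ^ ?e \<le> B * card (F ` carrier G)"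
    using quotient_growth_lower ..
  have "quotient_growth G N \<phi> k \<le> U * k ^ ?e \<and> k ^ ?e \<le> B * quotient_growth G N \<phi> k"
    if k: "k \<ge> 1" for k
    using quotient_growth_separates[of k] U[rule_format, OF k] B[rule_format, OF k] by auto
  then have Q: "(\<lambda>k. real (quotient_growth G N \<phi> k)) \<in> \<Theta>(\<lambda>k. real k ^ ?e)"
    by (intro bigtheta_power_nat[where U = U and B = B and m = 1]) auto
  obtain V where "\<forall>r\<ge>1. finite (twisted_class G \<phi> ` word_ball G S r) \<and>
     twisted_growth G S \<phi> r \<le> V * r ^ ?e"
    using twisted_growth_upper ..
  moreover obtain W r0 where "\<forall>r\<ge>r0. r ^ ?e \<le> W * twisted_growth G S \<phi> r"
    using twisted_growth_lower by blast
  ultimately have R: "(\<lambda>k. real (twisted_growth G S \<phi> k)) \<in> \<Theta>(\<lambda>k. real k ^ ?e)"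
    by (intro bigtheta_power_nat) auto
  have "(\<lambda>k. real k ^ ?e) \<in> \<Theta>(\<lambda>k. real (twisted_growth G S \<phi> k))"
    using R by (simp add: bigtheta_sym)
  with Q have "(\<lambda>k. real (quotient_growth G N \<phi> k)) \<in> \<Theta>(\<lambda>k. real (twisted_growth G S \<phi> k))"
    by (rule landau_theta.trans)
  with R show ?thesis by blast
qed

end
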